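(* Let $(\mathcal{H},[\cdot,\cdot])$ be a complex Kreĭn space and let $$K(\xi,\eta)=\exp\Big(\frac{i\,\Im[\eta,\xi]}{2}\Big)\exp\Big(-\frac{[\xi-\eta,\xi-\eta]}{4}\Big),\qquad \xi,\eta\in\mathcal{H}.$$ Put $\alpha(\xi,\eta)=\exp\big(-\tfrac{i\,\Im[\xi,\eta]}{2}\big)$ and $\sigma(\xi,\eta)=\exp\big(\tfrac{i\,\Im[\xi,\eta]}{2}\big)$. Then the kernel $K$ has a Kolmogorov decomposition $(V,\mathcal{K})$ with the property that the operators $W(\xi)$, $\xi\in\mathcal{H}$, defined by the formula $$\alpha(\xi,\eta)W(\xi)V(\eta)=V(\xi+\eta),\qquad \eta\in\mathcal{H},$$ are defined on the common dense domain $\bigvee_{\xi\in\mathcal{H}}V(\xi)\mathbb{C}$ in $\mathcal{K}$ and satisfy the canonical commutation relations $$W(\xi)W(\eta)=\sigma(\xi,\eta)W(\xi+\eta),\qquad \xi,\eta\in\mathcal{H}.$$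
   Context: A Kreĭn space is an indefinite inner product space $(\mathcal{H},[\cdot,\cdot])$ (linear in the first variable) for which there is a positive inner product $\langle\cdot,\cdot\rangle$ turning $\mathcal{H}$ into a Hilbert space, and $J=J^*=J^{-1}$ on $\mathcal{H}$, with $[\xi,\eta]=\langle J\xi,\eta\rangle$. $\Im$ denotes imaginary part. $T^\sharp$ is the adjoint of a bounded operator with respect to the indefinite inner products. $K$ is a scalar hermitian kernel on the set $X=\mathcal{H}$ (values in $\mathcal{L}(\mathbb{C})=\mathbb{C}$). A Kolmogorov decomposition of $K$ is a pair $(V,\mathcal{K})$, where $\mathcal{K}$ is a Kreĭn space and $V(\xi)\in\mathcal{L}(\mathbb{C},\mathcal{K})$ is a bounded linear operator for each $\xi\in\mathcal{H}$, such that $K(\xi,\eta)=V(\xi)^\sharp V(\eta)$ for all $\xi,\eta$ and the linear span of $\bigcup_\xi V(\xi)\mathbb{C}$ is dense in $\mathcal{K}$. $\bigvee$ denotes the linear span, without closure. The operators $W(\xi)$ are linear and possibly unbounded. *)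

theory Defs
  imports "HOL-Analysis.Analysis" "HOL-Library.Function_Algebras"
begin

text \<open>
  Complex inner product spaces are carried by a linear subspace \<open>S\<close> of a complex vector
  space type, so that Krein spaces can be quantified existentially inside a formula.
  Forms and operators are only meaningful on \<open>S\<close>.
\<close>

locale indefinite_inner_product_space = vector_space scl
  for scl :: "complex \<Rightarrow> 'b::ab_group_add \<Rightarrow> 'b" +
  fixes S :: "'b set" and ip :: "'b \<Rightarrow> 'b \<Rightarrow> complex"
  assumes subspace_S: "subspace S"
    and ip_add_left: "\<lbrakk>x \<in> S; y \<in> S; z \<in> S\<rbrakk> \<Longrightarrow> ip (x + y) z = ip x z + ip y z"
    and ip_scale_left: "\<lbrakk>x \<in> S; z \<in> S\<rbrakk> \<Longrightarrow> ip (scl c x) z = c * ip x z"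
    and ip_hermitian: "\<lbrakk>x \<in> S; y \<in> S\<rbrakk> \<Longrightarrow> ip y x = cnj (ip x y)"

definition ip_norm :: "('b \<Rightarrow> 'b \<Rightarrow> complex) \<Rightarrow> 'b \<Rightarrow> real" where
  "ip_norm hip x = sqrt (Re (hip x x))"

text \<open>
  The locale \<^locale>\<open>Metric_space\<close> requires nonnegativity and symmetry of the distance on the whole
  type, hence the value \<open>0\<close> off \<open>S\<close>; see \<open>Metric_space_ip_dist\<close> below.
\<close>

definition ip_dist :: "'b::ab_group_add set \<Rightarrow> ('b \<Rightarrow> 'b \<Rightarrow> complex) \<Rightarrow> 'b \<Rightarrow> 'b \<Rightarrow> real" where
  "ip_dist S hip x y = (if x \<in> S \<and> y \<in> S then ip_norm hip (x - y) else 0)"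

locale positive_inner_product_space = indefinite_inner_product_space +
  assumes ip_pos: "\<lbrakk>x \<in> S; x \<noteq> 0\<rbrakk> \<Longrightarrow> Re (ip x x) > 0"

locale hilbert_space_on = positive_inner_product_space +
  assumes complete: "Metric_space.mcomplete S (ip_dist S ip)"

definition linear_on_subspace ::
  "(complex \<Rightarrow> 'b::ab_group_add \<Rightarrow> 'b) \<Rightarrow> 'b set \<Rightarrow> ('b \<Rightarrow> 'b) \<Rightarrow> bool" where
  "linear_on_subspace scl S T \<longleftrightarrow>
     (\<forall>x\<in>S. \<forall>y\<in>S. T (x + y) = T x + T y) \<and> (\<forall>c. \<forall>x\<in>S. T (scl c x) = scl c (T x))"

text \<open>
  \<open>hip\<close> is a Hilbert space inner product, \<open>J = J\<^sup>* = J\<^sup>-\<^sup>1\<close> with respect to it, and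
  \<open>ip x y = hip (J x) y\<close>.
\<close>

definition fundamental_symmetry ::
  "(complex \<Rightarrow> 'b::ab_group_add \<Rightarrow> 'b) \<Rightarrow> 'b set \<Rightarrow> ('b \<Rightarrow> 'b \<Rightarrow> complex) \<Rightarrow>
   ('b \<Rightarrow> 'b \<Rightarrow> complex) \<Rightarrow> ('b \<Rightarrow> 'b) \<Rightarrow> bool" where
  "fundamental_symmetry scl S ip hip J \<longleftrightarrow>
     hilbert_space_on scl S hip \<and>
     linear_on_subspace scl S J \<and> J ` S \<subseteq> S \<and>
     (\<forall>x\<in>S. J (J x) = x) \<and>
     (\<forall>x\<in>S. \<forall>y\<in>S. hip (J x) y = hip x (J y)) \<and>
     (\<forall>x\<in>S. \<forall>y\<in>S. ip x y = hip (J x) y)"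

locale krein_space = indefinite_inner_product_space +
  assumes ex_fundamental_symmetry: "\<exists>hip J. fundamental_symmetry scl S ip hip J"

text \<open>
  The topology of a Krein space is the norm topology of \<open>hip\<close>. All fundamental symmetries give
  equivalent norms; the topological notions below require the property for each of them, and
  are used only together with \<^locale>\<open>krein_space\<close>, which provides one.
\<close>

definition krein_dense ::
  "(complex \<Rightarrow> 'b::ab_group_add \<Rightarrow> 'b) \<Rightarrow> 'b set \<Rightarrow> ('b \<Rightarrow> 'b \<Rightarrow> complex) \<Rightarrow> 'b set \<Rightarrow> bool" where
  "krein_dense scl S ip D \<longleftrightarrow>
     D \<subseteq> S \<and>
     (\<forall>hip J. fundamental_symmetry scl S ip hip J \<longrightarrow>
        Metric_space.mtopology S (ip_dist S hip) closure_of D = S)"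

definition bounded_linear_from_complex ::
  "(complex \<Rightarrow> 'b::ab_group_add \<Rightarrow> 'b) \<Rightarrow> 'b set \<Rightarrow> ('b \<Rightarrow> 'b \<Rightarrow> complex) \<Rightarrow> (complex \<Rightarrow> 'b) \<Rightarrow> bool" where
  "bounded_linear_from_complex scl S ip T \<longleftrightarrow>
     Vector_Spaces.linear (*) scl T \<and> range T \<subseteq> S \<and>
     (\<forall>hip J. fundamental_symmetry scl S ip hip J \<longrightarrow>
        (\<exists>B. \<forall>z. ip_norm hip (T z) \<le> B * cmod z))"

definition complex_ip :: "complex \<Rightarrow> complex \<Rightarrow> complex" where
  "complex_ip z w = z * cnj w"

text \<open>
  Adjoint of \<open>T\<close> with respect to the forms \<open>ip1\<close> on \<open>S1\<close> and \<open>ip2\<close> on the codomain: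
  \<open>ip2 (T u) y = ip1 u (T\<^sup>\<sharp> y)\<close>.
\<close>

definition krein_adjoint ::
  "'a set \<Rightarrow> ('a \<Rightarrow> 'a \<Rightarrow> complex) \<Rightarrow> ('b \<Rightarrow> 'b \<Rightarrow> complex) \<Rightarrow> ('a \<Rightarrow> 'b) \<Rightarrow> 'b \<Rightarrow> 'a" where
  "krein_adjoint S1 ip1 ip2 T y = (THE x. x \<in> S1 \<and> (\<forall>u\<in>S1. ip2 (T u) y = ip1 u x))"

definition range_span ::
  "(complex \<Rightarrow> 'b::ab_group_add \<Rightarrow> 'b) \<Rightarrow> ('x \<Rightarrow> complex \<Rightarrow> 'b) \<Rightarrow> 'b set" where
  "range_span scl V = module.span scl (\<Union>\<xi>. range (V \<xi>))"

text \<open>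
  The value \<open>K \<xi> \<eta>\<close> of a scalar kernel is identified with the operator of multiplication by
  \<open>K \<xi> \<eta>\<close> on the complex numbers.
\<close>

definition kolmogorov_decomposition ::
  "('x \<Rightarrow> 'x \<Rightarrow> complex) \<Rightarrow> (complex \<Rightarrow> 'b::ab_group_add \<Rightarrow> 'b) \<Rightarrow> 'b set \<Rightarrow>
   ('b \<Rightarrow> 'b \<Rightarrow> complex) \<Rightarrow> ('x \<Rightarrow> complex \<Rightarrow> 'b) \<Rightarrow> bool" where
  "kolmogorov_decomposition K scl S ip V \<longleftrightarrow>
     krein_space scl S ip \<and>
     (\<forall>\<xi>. bounded_linear_from_complex scl S ip (V \<xi>)) \<and>
     (\<forall>\<xi> \<eta> z. krein_adjoint UNIV complex_ip ip (V \<xi>) (V \<eta> z) = K \<xi> \<eta> * z) \<and>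
     krein_dense scl S ip (range_span scl V)"

text \<open>
  Possibly unbounded operators in \<open>S\<close> are partial maps, so that equality of operators includes
  equality of domains, and \<open>\<circ>\<^sub>m\<close> is the product with its maximal domain.
\<close>

definition unbounded_operator ::
  "(complex \<Rightarrow> 'b::ab_group_add \<Rightarrow> 'b) \<Rightarrow> 'b set \<Rightarrow> ('b \<rightharpoonup> 'b) \<Rightarrow> bool" where
  "unbounded_operator scl S T \<longleftrightarrow>
     module.subspace scl (dom T) \<and> dom T \<subseteq> S \<and> ran T \<subseteq> S \<and>
     linear_on_subspace scl (dom T) (\<lambda>x. the (T x))"

definition scale_operator ::
  "(complex \<Rightarrow> 'b \<Rightarrow> 'b) \<Rightarrow> complex \<Rightarrow> ('b \<rightharpoonup> 'b) \<Rightarrow> ('b \<rightharpoonup> 'b)" where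
  "scale_operator scl c T = (\<lambda>x. map_option (scl c) (T x))"

definition weyl_operators ::
  "('x::plus \<Rightarrow> 'x \<Rightarrow> complex) \<Rightarrow> (complex \<Rightarrow> 'b::ab_group_add \<Rightarrow> 'b) \<Rightarrow> 'b set \<Rightarrow>
   ('x \<Rightarrow> complex \<Rightarrow> 'b) \<Rightarrow> ('x \<Rightarrow> ('b \<rightharpoonup> 'b)) \<Rightarrow> bool" where
  "weyl_operators \<alpha> scl S V W \<longleftrightarrow>
     (\<forall>\<xi>. unbounded_operator scl S (W \<xi>) \<and>
          dom (W \<xi>) = range_span scl V \<and>
          (\<forall>\<eta> z. scale_operator scl (\<alpha> \<xi> \<eta>) (W \<xi>) (V \<eta> z) = Some (V (\<xi> + \<eta>) z)))"

text \<open>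
  Scalar multiplication accompanying the pointwise addition of \<open>HOL-Library.Function_Algebras\<close>.
  A linear subspace of functions \<open>'x \<Rightarrow> complex\<close> can carry any Kolmogorov decomposition of a
  kernel on \<open>'x\<close> up to isomorphism: \<open>k \<mapsto> (\<lambda>\<xi>. V(\<xi>)\<^sup>\<sharp> k)\<close> is linear, and injective by density.
\<close>

definition fun_scale :: "complex \<Rightarrow> ('x \<Rightarrow> complex) \<Rightarrow> 'x \<Rightarrow> complex" where
  "fun_scale c f = (\<lambda>x. c * f x)"

lemma vector_space_fun_scale: "vector_space fun_scale"
  by unfold_locales (auto simp: fun_scale_def fun_eq_iff algebra_simps)

context indefinite_inner_product_space
begin

lemma ip_add_right: "\<lbrakk>x \<in> S; y \<in> S; z \<in> S\<rbrakk> \<Longrightarrow> ip z (x + y) = ip z x + ip z y"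
  by (metis complex_cnj_add ip_add_left ip_hermitian subspace_S subspace_add)

lemma ip_scale_right: "\<lbrakk>x \<in> S; z \<in> S\<rbrakk> \<Longrightarrow> ip z (scl c x) = cnj c * ip z x"
  by (metis complex_cnj_mult ip_scale_left ip_hermitian subspace_S subspace_scale)

lemma ip_zero_left: "z \<in> S \<Longrightarrow> ip 0 z = 0"
  using ip_scale_left[of z z 0] by simp

lemma ip_self_real: "x \<in> S \<Longrightarrow> Im (ip x x) = 0"
  using ip_hermitian[of x x] by (metis complex_cnj_cancel_iff Im_complex_of_real Reals_cnj_iff complex_is_Real_iff)

end

context positive_inner_product_space
begin

lemma ip_nonneg: "x \<in> S \<Longrightarrow> Re (ip x x) \<ge> 0"
  using ip_pos[of x] ip_zero_left[of 0] by (cases "x = 0") force+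

lemma Re_ip_le:
  assumes "x \<in> S" "y \<in> S"
  shows "Re (ip x y) \<le> ip_norm ip x * ip_norm ip y"
proof -
  let ?a = "Re (ip x x)" and ?b = "Re (ip y y)" and ?r = "Re (ip x y)"
  have Ryx: "Re (ip y x) = ?r"
    using ip_hermitian[OF assms] by simp
  have q: "t^2 * ?a + 2 * t * s * ?r + s^2 * ?b \<ge> 0" for s t :: real
  proof -
    let ?tx = "scl (of_real t) x" and ?sy = "scl (of_real s) y"
    have m: "?tx \<in> S" "?sy \<in> S" "?tx + ?sy \<in> S"
      using assms subspace_S by (auto intro: subspace_scale subspace_add)
    have "0 \<le> Re (ip (?tx + ?sy) (?tx + ?sy))"
      using ip_nonneg m by blast
    also have "\<dots> = t^2 * ?a + 2 * t * s * ?r + s^2 * ?b"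
      using m assms
      by (simp add: ip_add_left ip_add_right ip_scale_left ip_scale_right Ryx
          power2_eq_square algebra_simps)
    finally show ?thesis .
  qed
  have a0: "?a \<ge> 0" and b0: "?b \<ge> 0"
    using ip_nonneg assms by auto
  have "?r^2 \<le> ?a * ?b"
  proof (cases "?a = 0")
    case True
    then have "x = 0" using ip_pos[OF assms(1)] by force
    then show ?thesis using ip_zero_left[OF assms(2)] a0 b0 by simp
  next
    case False
    have "0 \<le> ?r^2 * ?a + 2 * ?r * (- ?a) * ?r + (- ?a)^2 * ?b"
      using q[of ?r "- ?a"] by simp
    also have "\<dots> = ?a * (?a * ?b - ?r^2)"
      by (simp add: power2_eq_square algebra_simps)
    finally show ?thesis
      using a0 False by (simp add: zero_le_mult_iff)
  qed
  then have "\<bar>?r\<bar> \<le> sqrt (?a * ?b)"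
    using real_le_rsqrt by simp
  then show ?thesis
    by (simp add: ip_norm_def real_sqrt_mult)
qed

lemma ip_norm_triangle:
  assumes "x \<in> S" "y \<in> S"
  shows "ip_norm ip (x + y) \<le> ip_norm ip x + ip_norm ip y"
proof -
  have s: "x + y \<in> S" using assms subspace_S by (auto intro: subspace_add)
  have "Re (ip (x + y) (x + y)) = Re (ip x x) + 2 * Re (ip x y) + Re (ip y y)"
    using assms s ip_hermitian[OF assms] by (simp add: ip_add_left ip_add_right)
  also have "\<dots> \<le> (ip_norm ip x)^2 + 2 * (ip_norm ip x * ip_norm ip y) + (ip_norm ip y)^2"
    using Re_ip_le[OF assms] ip_nonneg assms by (simp add: ip_norm_def)
  also have "\<dots> = (ip_norm ip x + ip_norm ip y)^2"
    by (simp add: power2_eq_square algebra_simps)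
  finally show ?thesis
    using ip_nonneg assms unfolding ip_norm_def[of ip "x + y"]
    by (intro real_le_lsqrt) (auto simp: ip_norm_def)
qed

lemma Metric_space_ip_dist: "Metric_space S (ip_dist S ip)"
proof
  have d: "x - y \<in> S" if "x \<in> S" "y \<in> S" for x y
    using that subspace_S by (auto intro: subspace_diff)
  fix x y z
  show "0 \<le> ip_dist S ip x y"
    using ip_nonneg d by (simp add: ip_dist_def ip_norm_def)
  show "ip_dist S ip x y = ip_dist S ip y x"
  proof (cases "x \<in> S \<and> y \<in> S")
    case True
    have "y - x = scl (-1) (x - y)" by simp
    then have "ip (y - x) (y - x) = ip (x - y) (x - y)"
      using d True ip_scale_left ip_scale_right subspace_S
      by (metis complex_cnj_minus complex_cnj_one minus_mult_minus mult_1 mult.assoc)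
    then show ?thesis
      by (simp add: ip_dist_def ip_norm_def)
  qed (auto simp: ip_dist_def)
  show "(ip_dist S ip x y = 0) = (x = y)" if "x \<in> S" "y \<in> S"
  proof
    assume "ip_dist S ip x y = 0"
    then have "Re (ip (x - y) (x - y)) = 0"
      using that by (simp add: ip_dist_def ip_norm_def)
    then show "x = y"
      using ip_pos[OF d[OF that]] by force
  next
    assume "x = y"
    then show "ip_dist S ip x y = 0"
      using ip_zero_left subspace_S subspace_0 by (simp add: ip_dist_def ip_norm_def)
  qed
  show "ip_dist S ip x z \<le> ip_dist S ip x y + ip_dist S ip y z"
    if "x \<in> S" "y \<in> S" "z \<in> S"
    using ip_norm_triangle[of "x - y" "y - z"] d that by (simp add: ip_dist_def)
qed

end

end

theory Submission
  imports Defs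
begin

text \<open>
  Fix a fundamental symmetry \<open>J\<close> with Hilbert inner product \<open>\<langle>\<cdot>,\<cdot>\<rangle>\<close>. The kernel factorises as
  \<open>K(\<xi>,\<eta>) = g(\<xi>) g(\<eta>) exp([\<eta>,\<xi>]/2)\<close> with \<open>g(\<xi>) = exp(-[\<xi>,\<xi>]/4)\<close>. The Krein space is the Fock space,
  realised as the reproducing kernel Hilbert space of the positive kernel \<open>exp(\<langle>\<eta>,\<xi>\<rangle>/2)\<close> of
  antiholomorphic functions, with symmetry \<open>f \<mapsto> f \<circ> J\<close>, and \<open>V(\<eta>)\<close> maps \<open>1\<close> to \<open>g(\<eta>)\<close> times the kernel
  function at \<open>\<eta>\<close>. On functions the operator \<open>W(\<xi>)\<close> is the weighted translation
  \<open>f \<mapsto> g(\<xi>) exp(\<langle>\<xi>,\<cdot>\<rangle>/2) f(\<cdot> - J\<xi>)\<close>, so it is well defined on the span, and the commutation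
  relations reduce to \<open>\<sigma>(\<xi>,\<eta>) g(\<xi>+\<eta>) = g(\<xi>) g(\<eta>) exp(-[\<eta>,\<xi>]/2)\<close>.
\<close>

section \<open>Semi-inner product spaces and orthogonality\<close>

lemma module_fun_scale: "module fun_scale"
  using vector_space_fun_scale by (simp add: module_iff_vector_space)

text \<open>The Gram form on finitely supported coefficients can have null vectors, so the norm
  estimates are developed under semidefiniteness; positive spaces inherit them.\<close>

locale semi_inner_product_space = indefinite_inner_product_space +
  assumes ip_self_nonneg: "x \<in> S \<Longrightarrow> 0 \<le> Re (ip x x)"
begin

lemma mem_add: "\<lbrakk>x \<in> S; y \<in> S\<rbrakk> \<Longrightarrow> x + y \<in> S"
  and mem_diff: "\<lbrakk>x \<in> S; y \<in> S\<rbrakk> \<Longrightarrow> x - y \<in> S"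
  and mem_scale: "x \<in> S \<Longrightarrow> scl c x \<in> S"
  and mem_0: "0 \<in> S"
  using subspace_S by (auto intro: subspace_add subspace_diff subspace_scale subspace_0)

lemma ip_diff_left: "\<lbrakk>x \<in> S; y \<in> S; z \<in> S\<rbrakk> \<Longrightarrow> ip (x - y) z = ip x z - ip y z"
  by (metis add_diff_cancel diff_add_cancel ip_add_left mem_diff)

lemma ip_diff_right: "\<lbrakk>x \<in> S; y \<in> S; z \<in> S\<rbrakk> \<Longrightarrow> ip z (x - y) = ip z x - ip z y"
  by (metis add_diff_cancel diff_add_cancel ip_add_right mem_diff)

lemma ip_norm_nonneg: "x \<in> S \<Longrightarrow> 0 \<le> ip_norm ip x"
  by (simp add: ip_norm_def ip_self_nonneg)

lemma ip_norm_power2: "x \<in> S \<Longrightarrow> (ip_norm ip x)\<^sup>2 = Re (ip x x)"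
  by (simp add: ip_norm_def ip_self_nonneg)

text \<open>The factor \<open>ip x y\<close> aligns the phases, which leaves a real quadratic
  polynomial in \<open>s\<close>. Its sign yields Cauchy-Schwarz, and later the orthogonality of a
  nearest-point residual.\<close>

lemma Re_ip_add_scale:
  assumes "x \<in> S" "y \<in> S"
  shows "Re (ip (x + scl (of_real s * ip x y) y) (x + scl (of_real s * ip x y) y))
    = Re (ip x x) + 2 * s * (cmod (ip x y))\<^sup>2 + s\<^sup>2 * (cmod (ip x y))\<^sup>2 * Re (ip y y)"
  using assms ip_hermitian[OF assms] ip_self_real[OF assms(2)] unfolding cmod_power2
  by (simp add: ip_add_left ip_add_right ip_scale_left ip_scale_right mem_add mem_scale
      power2_eq_square algebra_simps)

lemma cmod_ip_le:
  assumes "x \<in> S" "y \<in> S"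
  shows "cmod (ip x y) \<le> ip_norm ip x * ip_norm ip y"
proof -
  define a b c where "a = Re (ip x x)" and "b = Re (ip y y)" and "c = (cmod (ip x y))\<^sup>2"
  have q: "0 \<le> a + 2 * s * c + s\<^sup>2 * c * b" for s
    using ip_self_nonneg[of "x + scl (of_real s * ip x y) y"] assms
    unfolding Re_ip_add_scale[OF assms] a_def b_def c_def by (simp add: mem_add mem_scale)
  have nn: "0 \<le> a" "0 \<le> b" "0 \<le> c"
    using assms by (auto simp: a_def b_def c_def ip_self_nonneg)
  have "c \<le> a * b"
  proof (cases "b = 0")
    case True
    have "c = 0"
    proof (rule ccontr)
      assume "c \<noteq> 0"
      \<comment> \<open>With \<open>b = 0\<close> the polynomial is affine in \<open>s\<close>; the
        chosen value makes it equal to -1.\<close>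
      then show False
        using q[of "- (a + 1) / (2 * c)"] True nn by (simp add: field_simps)
    qed
    then show ?thesis using nn by simp
  next
    case False
    \<comment> \<open>The value \<open>s = - 1 / b\<close> minimises the quadratic and leaves
      \<open>a - c / b\<close>.\<close>
    then show ?thesis
      using q[of "- 1 / b"] nn by (simp add: field_simps power2_eq_square)
  qed
  then show ?thesis
    using real_le_rsqrt[of "cmod (ip x y)" "a * b"]
    by (simp add: c_def a_def b_def ip_norm_def real_sqrt_mult)
qed

lemma ip_norm_add_le:
  assumes "x \<in> S" "y \<in> S"
  shows "ip_norm ip (x + y) \<le> ip_norm ip x + ip_norm ip y"
proof -
  have "Re (ip (x + y) (x + y)) = Re (ip x x) + 2 * Re (ip x y) + Re (ip y y)"
    using assms ip_hermitian[OF assms] by (simp add: ip_add_left ip_add_right mem_add)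
  also have "\<dots> \<le> (ip_norm ip x)\<^sup>2 + 2 * (ip_norm ip x * ip_norm ip y) + (ip_norm ip y)\<^sup>2"
    using order_trans[OF complex_Re_le_cmod cmod_ip_le[OF assms]] assms
    by (simp add: ip_norm_power2)
  also have "\<dots> = (ip_norm ip x + ip_norm ip y)\<^sup>2"
    by (simp add: power2_eq_square algebra_simps)
  finally show ?thesis
    using ip_norm_nonneg assms unfolding ip_norm_def[of ip "x + y"]
    by (intro real_le_lsqrt) (auto simp: ip_self_nonneg mem_add)
qed

lemma ip_norm_scale:
  assumes "x \<in> S"
  shows "ip_norm ip (scl c x) = cmod c * ip_norm ip x"
proof -
  have "ip (scl c x) (scl c x) = of_real ((cmod c)\<^sup>2) * ip x x"
    using assms complex_norm_square[of c]
    by (simp add: ip_scale_left ip_scale_right mem_scale)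
  then show ?thesis
    by (simp add: ip_norm_def real_sqrt_mult)
qed

lemma ip_norm_minus: "x \<in> S \<Longrightarrow> ip_norm ip (- x) = ip_norm ip x"
  using ip_norm_scale[of x "-1"] by simp

lemma ip_norm_diff_commute: "\<lbrakk>x \<in> S; y \<in> S\<rbrakk> \<Longrightarrow> ip_norm ip (x - y) = ip_norm ip (y - x)"
  using ip_norm_minus[of "x - y"] mem_diff by simp

lemma ip_norm_diff_triangle:
  "\<lbrakk>x \<in> S; y \<in> S; z \<in> S\<rbrakk> \<Longrightarrow> ip_norm ip (x - z) \<le> ip_norm ip (x - y) + ip_norm ip (y - z)"
  using ip_norm_add_le[of "x - y" "y - z"] by (simp add: mem_diff)

lemma parallelogram:
  "\<lbrakk>x \<in> S; y \<in> S\<rbrakk> \<Longrightarrow> (ip_norm ip (x + y))\<^sup>2 + (ip_norm ip (x - y))\<^sup>2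
    = 2 * (ip_norm ip x)\<^sup>2 + 2 * (ip_norm ip y)\<^sup>2"
  by (simp add: ip_norm_power2 mem_add mem_diff ip_add_left ip_add_right ip_diff_left ip_diff_right)

end

sublocale positive_inner_product_space \<subseteq> semi_inner_product_space
  by unfold_locales (rule ip_nonneg)

section \<open>Nearest points and a density criterion\<close>

context hilbert_space_on
begin

text \<open>The projection argument. A sequence in \<open>D\<close> minimising the distance to
  \<open>x\<close> is Cauchy, and by completeness it has a limit \<open>p\<close>. Minimality makes
  \<open>x - p\<close> orthogonal to \<open>D\<close>, so \<open>x = p\<close> is a limit of points
  of \<open>D\<close>.\<close>

lemma dense_if_orthogonal_trivial:
  assumes D: "subspace D" "D \<subseteq> S"
    and triv: "\<And>x. \<lbrakk>x \<in> S; \<And>y. y \<in> D \<Longrightarrow> ip x y = 0\<rbrakk> \<Longrightarrow> x = 0"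
  shows "Metric_space.mtopology S (ip_dist S ip) closure_of D = S"
proof -
  interpret M: Metric_space S "ip_dist S ip"
    by (rule Metric_space_ip_dist)
  have dist: "ip_dist S ip x y = ip_norm ip (x - y)" if "x \<in> S" "y \<in> S" for x y
    using that by (simp add: ip_dist_def)
  have "\<exists>y\<in>D. y \<in> M.mball x r" if x: "x \<in> S" and r: "r > 0" for x r
  proof -
    define d where "d = (INF m\<in>D. ip_norm ip (x - m))"
    have bdd: "bdd_below ((\<lambda>m. ip_norm ip (x - m)) ` D)"
      using D x by (intro bdd_belowI2[where m = 0]) (auto intro: ip_norm_nonneg mem_diff)
    have d_le: "d \<le> ip_norm ip (x - m)" if "m \<in> D" for m
      unfolding d_def using bdd that by (rule cINF_lower)
    have D0: "D \<noteq> {}" using D subspace_0 by blast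
    have d0: "0 \<le> d"
      unfolding d_def using D0 D x by (intro cINF_greatest) (auto intro: ip_norm_nonneg mem_diff)
    have "\<exists>m\<in>D. ip_norm ip (x - m) < d + 1 / Suc n" for n
      using cINF_less_iff[OF D0 bdd, of "d + 1 / Suc n"] by (simp add: d_def)
    then obtain m where m: "\<And>n. m n \<in> D" "\<And>n. ip_norm ip (x - m n) < d + 1 / Suc n"
      by metis
    have mS: "m n \<in> S" for n using m D by blast
    \<comment> \<open>The midpoint \<open>h\<close> of \<open>m i\<close> and \<open>m j\<close>
      lies in \<open>D\<close>, so the sum of the two residuals has norm at least
      \<open>2 * d\<close>. The parallelogram law then bounds their difference by the excess of the
      squared distances over the square of \<open>d\<close>.\<close>
    have close: "(ip_norm ip (m i - m j))\<^sup>2 \<le> (8 * d + 4) / Suc n" if "i \<ge> n" "j \<ge> n" for i j n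
    proof -
      have s: "(ip_norm ip (x - m i))\<^sup>2 \<le> d\<^sup>2 + (2 * d + 1) / Suc n" if "i \<ge> n" for i
      proof -
        have "ip_norm ip (x - m i) \<le> d + 1 / Suc i" using m(2)[of i] by simp
        also have "\<dots> \<le> d + 1 / Suc n" using that by (simp add: frac_le)
        finally have "(ip_norm ip (x - m i))\<^sup>2 \<le> (d + 1 / Suc n)\<^sup>2"
          using x mS by (intro power_mono ip_norm_nonneg mem_diff)
        also have "\<dots> = d\<^sup>2 + 2 * d / Suc n + (1 / Suc n) * (1 / Suc n)"
          by (simp add: power2_eq_square algebra_simps)
        also have "\<dots> \<le> d\<^sup>2 + 2 * d / Suc n + 1 * (1 / Suc n)"
          by (intro add_left_mono mult_right_mono) auto
        finally show ?thesis by (simp add: add_divide_distrib)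
      qed
      define h where "h = scl (1/2) (m i + m j)"
      have hD: "h \<in> D" unfolding h_def using D m by (auto intro: subspace_add subspace_scale)
      have "scl 2 (x - h) = (x - m i) + (x - m j)"
        by (simp add: h_def scale_right_diff_distrib scale_left_distrib
            scale_left_distrib[of 1 1, simplified] algebra_simps)
      then have "ip_norm ip ((x - m i) + (x - m j)) = 2 * ip_norm ip (x - h)"
        using ip_norm_scale[of "x - h" 2] hD D x by (auto simp: mem_diff)
      then have "4 * d\<^sup>2 \<le> (ip_norm ip ((x - m i) + (x - m j)))\<^sup>2"
        using power_mono[OF d_le[OF hD] d0, of 2] by (simp add: power_mult_distrib)
      moreover have "(x - m i) - (x - m j) = - (m i - m j)" by simp
      then have "ip_norm ip ((x - m i) - (x - m j)) = ip_norm ip (m i - m j)"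
        using ip_norm_minus mS mem_diff by metis
      ultimately have "(ip_norm ip (m i - m j))\<^sup>2 + 4 * d\<^sup>2 \<le>
          2 * (ip_norm ip (x - m i))\<^sup>2 + 2 * (ip_norm ip (x - m j))\<^sup>2"
        using parallelogram[of "x - m i" "x - m j"] x mS by (simp add: mem_diff)
      also have "\<dots> \<le> 4 * (d\<^sup>2 + (2 * d + 1) / Suc n)"
        using s[OF that(1)] s[OF that(2)] by argo
      finally show ?thesis by (simp add: add_divide_distrib)
    qed
    have "M.MCauchy m"
      unfolding M.MCauchy_def
    proof (intro conjI allI impI)
      fix e :: real assume e: "e > 0"
      obtain N where N: "(8 * d + 4) / Suc N < e\<^sup>2"
      proof -
        obtain N where "(8 * d + 4) / e\<^sup>2 < real N" using reals_Archimedean2 by blast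
        then have "(8 * d + 4) / Suc N < e\<^sup>2" using e by (simp add: field_simps) (smt (verit) zero_less_power)
        then show ?thesis using that by blast
      qed
      show "\<exists>N. \<forall>n n'. N \<le> n \<longrightarrow> N \<le> n' \<longrightarrow> ip_dist S ip (m n) (m n') < e"
      proof (intro exI allI impI)
        fix i j assume "N \<le> i" "N \<le> j"
        then have "(ip_norm ip (m i - m j))\<^sup>2 < e\<^sup>2" using close N by fastforce
        then show "ip_dist S ip (m i) (m j) < e"
          using e mS by (simp add: dist power_less_imp_less_base)
      qed
    qed (use mS in auto)
    then obtain p where p: "limitin M.mtopology m p sequentially"
      using complete M.mcomplete_def by blast
    then have pS: "p \<in> S" and plim: "\<And>e. e > 0 \<Longrightarrow> \<forall>\<^sub>F n in sequentially. ip_norm ip (m n - p) < e"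
      using mS by (auto simp: M.limitin_metric dist)
    have px: "ip_norm ip (x - p) \<le> d"
    proof (rule field_le_epsilon)
      fix e :: real assume e: "e > 0"
      have "(\<lambda>n. 1 / real (Suc n)) \<longlonglongrightarrow> 0" by (rule lim_1_over_n[THEN LIMSEQ_Suc])
      then have "\<forall>\<^sub>F n in sequentially. 1 / real (Suc n) < e/2"
        using order_tendstoD(2)[of _ 0 _ "e/2"] e by fastforce
      then obtain n where "1 / real (Suc n) < e/2" "ip_norm ip (m n - p) < e/2"
        using eventually_happens[OF eventually_conj[OF _ plim[of "e/2"]]] e by fastforce
      then show "ip_norm ip (x - p) \<le> d + e"
        using ip_norm_diff_triangle[OF x mS[of n] pS] m(2)[of n] by simp
    qed
    \<comment> \<open>The limit \<open>p\<close> may lie outside \<open>D\<close>; minimality is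
      therefore applied to the points \<open>m n - y\<close> of \<open>D\<close> and carried over as
      \<open>m n\<close> approaches \<open>p\<close>.\<close>
    have far: "d \<le> ip_norm ip ((x - p) + y)" if y: "y \<in> D" for y
    proof (rule field_le_epsilon)
      fix e :: real assume e: "e > 0"
      then obtain n where n: "ip_norm ip (m n - p) < e"
        using eventually_happens[OF plim[of "e"]] by auto
      have "m n - y \<in> D" using m D y by (auto intro: subspace_diff)
      then have "d \<le> ip_norm ip (x - (m n - y))" by (rule d_le)
      also have "x - (m n - y) = ((x - p) + y) - (m n - p)" by simp
      also have "ip_norm ip \<dots> \<le> ip_norm ip ((x - p) + y) + ip_norm ip (m n - p)"
        using ip_norm_add_le[of "(x - p) + y" "- (m n - p)"] ip_norm_minus[of "m n - p"]
          x pS mS y D mem_scale[of "m n - p" "-1"]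
        by (auto simp: mem_diff mem_add)
      finally show "d \<le> ip_norm ip ((x - p) + y) + e" using n by simp
    qed
    have "ip (x - p) y = 0" if y: "y \<in> D" for y
    proof (rule ccontr)
      assume ne: "ip (x - p) y \<noteq> 0"
      define c b where "c = (cmod (ip (x - p) y))\<^sup>2" and "b = Re (ip y y)"
      have yS: "y \<in> S" and wS: "x - p \<in> S" using y D x pS by (auto intro: mem_diff)
      have c: "c > 0" using ne by (simp add: c_def)
      have b: "b \<ge> 0" using yS by (simp add: b_def ip_nonneg)
      \<comment> \<open>A step slightly shorter than the optimal \<open>- 1 / b\<close>, which also
        covers \<open>b = 0\<close>. It keeps \<open>s < 0\<close> and \<open>2 + s * b > 0\<close>,
        so the perturbation would strictly shorten \<open>x - p\<close>.\<close>
      define s where "s = - 1 / (b + 1)"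
      let ?z = "scl (of_real s * ip (x - p) y) y"
      have "?z \<in> D" using y D by (auto intro: subspace_scale)
      from far[OF this] px have "ip_norm ip (x - p) \<le> ip_norm ip ((x - p) + ?z)" by linarith
      then have "Re (ip (x - p) (x - p)) \<le> Re (ip ((x - p) + ?z) ((x - p) + ?z))"
        by (simp add: ip_norm_def)
      then have "0 \<le> c * (s * (2 + s * b))"
        unfolding Re_ip_add_scale[OF wS yS] by (simp add: c_def b_def power2_eq_square algebra_simps)
      then have "0 \<le> s * (2 + s * b)" using c by (simp add: zero_le_mult_iff)
      moreover have "s < 0" "2 + s * b > 0" using b by (auto simp: s_def field_simps)
      ultimately show False by (simp add: zero_le_mult_iff)
    qed
    then have "x - p = 0" using mem_diff[OF x pS] by (intro triv)
    then have "x = p" by simp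
    then obtain n where "ip_norm ip (m n - x) < r"
      using eventually_happens[OF plim[OF r]] by auto
    then have "m n \<in> M.mball x r"
      using x mS ip_norm_diff_commute by (simp add: M.in_mball dist)
    then show ?thesis using m by blast
  qed
  then show ?thesis
    by (auto simp: M.metric_closure_of)
qed

end

section \<open>Completion of a semi-inner product space as a space of functions\<close>

text \<open>A vector is recorded by its inner products with the family \<open>k\<close>. Since
  \<open>k\<close> spans \<open>S\<close>, exactly the null vectors become the zero function, so
  passing to functions also performs the quotient by null vectors.\<close>

locale function_completion = semi_inner_product_space scl S ip
  for scl :: "complex \<Rightarrow> 'b::ab_group_add \<Rightarrow> 'b" and S ip +
  fixes k :: "'x \<Rightarrow> 'b"
  assumes k_mem: "k x \<in> S"
    and span_k: "S \<subseteq> span (range k)"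
begin

definition emb :: "'b \<Rightarrow> 'x \<Rightarrow> complex" where
  "emb a x = ip a (k x)"

definition Cauchy_in :: "(nat \<Rightarrow> 'b) \<Rightarrow> bool" where
  "Cauchy_in a \<longleftrightarrow> range a \<subseteq> S \<and> (\<forall>e>0. \<exists>N. \<forall>m\<ge>N. \<forall>n\<ge>N. ip_norm ip (a m - a n) < e)"

text \<open>The pointwise limit function plays the role of the equivalence class of a Cauchy
  sequence.\<close>

definition represents :: "(nat \<Rightarrow> 'b) \<Rightarrow> ('x \<Rightarrow> complex) \<Rightarrow> bool" where
  "represents a f \<longleftrightarrow> Cauchy_in a \<and> (\<forall>x. (\<lambda>n. emb (a n) x) \<longlonglongrightarrow> f x)"

definition compl :: "('x \<Rightarrow> complex) set" where
  "compl = {f. \<exists>a. represents a f}"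

text \<open>The representing sequences are chosen arbitrarily; \<open>ip_tendsto_compl_ip\<close>
  shows that every choice gives the same limit.\<close>

definition compl_ip :: "('x \<Rightarrow> complex) \<Rightarrow> ('x \<Rightarrow> complex) \<Rightarrow> complex" where
  "compl_ip f g = lim (\<lambda>n. ip ((SOME a. represents a f) n) ((SOME b. represents b g) n))"

lemma Cauchy_in_mem: "Cauchy_in a \<Longrightarrow> a n \<in> S"
  by (auto simp: Cauchy_in_def)

lemma emb_add: "\<lbrakk>a \<in> S; b \<in> S\<rbrakk> \<Longrightarrow> emb (a + b) = emb a + emb b"
  and emb_diff: "\<lbrakk>a \<in> S; b \<in> S\<rbrakk> \<Longrightarrow> emb (a - b) = emb a - emb b"
  and emb_scale: "a \<in> S \<Longrightarrow> emb (scl c a) = fun_scale c (emb a)"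
  by (auto simp: emb_def fun_scale_def ip_add_left ip_diff_left ip_scale_left k_mem)

section \<open>Cauchy sequences for the seminorm and their limit functions\<close>

lemma Cauchy_in_bounded:
  assumes "Cauchy_in a"
  obtains B where "B > 0" "\<And>n. ip_norm ip (a n) \<le> B"
proof -
  have mem: "a n \<in> S" for n using assms by (rule Cauchy_in_mem)
  obtain N where N: "\<And>m n. \<lbrakk>m \<ge> N; n \<ge> N\<rbrakk> \<Longrightarrow> ip_norm ip (a m - a n) < 1"
    using assms unfolding Cauchy_in_def by (meson zero_less_one)
  define B where "B = 1 + (\<Sum>n\<le>N. ip_norm ip (a n))"
  have nn: "0 \<le> ip_norm ip (a n)" for n using mem by (rule ip_norm_nonneg)
  have le: "ip_norm ip (a n) \<le> (\<Sum>n\<le>N. ip_norm ip (a n))" if "n \<le> N" for n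
    using that nn by (intro member_le_sum) auto
  have "ip_norm ip (a n) \<le> B" for n
  proof (cases "n \<le> N")
    case True
    then show ?thesis using le by (fastforce simp: B_def)
  next
    case False
    then have "ip_norm ip (a n - a N) < 1" using N by simp
    moreover have "ip_norm ip (a n) \<le> ip_norm ip (a n - a N) + ip_norm ip (a N)"
      using ip_norm_add_le[of "a n - a N" "a N"] mem by (simp add: mem_diff)
    ultimately show ?thesis using le[of N] by (simp add: B_def)
  qed
  moreover have "B > 0" unfolding B_def using nn by (smt (verit) sum_nonneg)
  ultimately show ?thesis using that by blast
qed

lemma Cauchy_in_add:
  assumes "Cauchy_in a" "Cauchy_in b"
  shows "Cauchy_in (\<lambda>n. a n + b n)"
  unfolding Cauchy_in_def
proof (intro conjI allI impI)
  show "range (\<lambda>n. a n + b n) \<subseteq> S" using assms by (auto intro: mem_add Cauchy_in_mem)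
  fix e :: real assume "e > 0"
  then obtain N M where "\<And>m n. \<lbrakk>m \<ge> N; n \<ge> N\<rbrakk> \<Longrightarrow> ip_norm ip (a m - a n) < e/2"
     "\<And>m n. \<lbrakk>m \<ge> M; n \<ge> M\<rbrakk> \<Longrightarrow> ip_norm ip (b m - b n) < e/2"
    using assms unfolding Cauchy_in_def by (meson half_gt_zero)
  moreover have "ip_norm ip ((a m + b m) - (a n + b n)) \<le> ip_norm ip (a m - a n) + ip_norm ip (b m - b n)"
    for m n
    using ip_norm_add_le[of "a m - a n" "b m - b n"] assms
    by (simp add: mem_diff Cauchy_in_mem algebra_simps)
  ultimately have "\<forall>m\<ge>max N M. \<forall>n\<ge>max N M. ip_norm ip ((a m + b m) - (a n + b n)) < e"
    by (smt (verit) field_sum_of_halves max.boundedE)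
  then show "\<exists>N. \<forall>m\<ge>N. \<forall>n\<ge>N. ip_norm ip ((a m + b m) - (a n + b n)) < e" by blast
qed

lemma Cauchy_in_scale:
  assumes "Cauchy_in a"
  shows "Cauchy_in (\<lambda>n. scl c (a n))"
  unfolding Cauchy_in_def
proof (intro conjI allI impI)
  show "range (\<lambda>n. scl c (a n)) \<subseteq> S" using assms by (auto intro: mem_scale Cauchy_in_mem)
  fix e :: real assume e: "e > 0"
  have "0 < e / (cmod c + 1)" using e by (simp add: pos_add_strict add_nonneg_pos)
  then obtain N where N: "\<And>m n. \<lbrakk>m \<ge> N; n \<ge> N\<rbrakk> \<Longrightarrow> ip_norm ip (a m - a n) < e / (cmod c + 1)"
    using assms unfolding Cauchy_in_def by meson
  have "ip_norm ip (scl c (a m) - scl c (a n)) < e" if "m \<ge> N" "n \<ge> N" for m n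
  proof -
    have "ip_norm ip (scl c (a m) - scl c (a n)) = cmod c * ip_norm ip (a m - a n)"
      using assms by (simp add: ip_norm_scale mem_diff Cauchy_in_mem flip: scale_right_diff_distrib)
    also have "\<dots> \<le> (cmod c + 1) * ip_norm ip (a m - a n)"
      using assms by (intro mult_right_mono ip_norm_nonneg) (auto simp: mem_diff Cauchy_in_mem)
    also have "\<dots> < e"
      using N[OF that] by (simp add: pos_less_divide_eq add_nonneg_pos mult.commute)
    finally show ?thesis .
  qed
  then show "\<exists>N. \<forall>m\<ge>N. \<forall>n\<ge>N. ip_norm ip (scl c (a m) - scl c (a n)) < e" by blast
qed

lemma represents_add: "\<lbrakk>represents a f; represents b g\<rbrakk> \<Longrightarrow> represents (\<lambda>n. a n + b n) (f + g)"
  by (auto simp: represents_def Cauchy_in_add emb_add Cauchy_in_mem intro!: tendsto_add)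

lemma represents_scale: "represents a f \<Longrightarrow> represents (\<lambda>n. scl c (a n)) (fun_scale c f)"
  by (auto simp: represents_def Cauchy_in_scale emb_scale Cauchy_in_mem fun_scale_def
      intro!: tendsto_mult)

lemma represents_diff: "\<lbrakk>represents a f; represents b g\<rbrakk> \<Longrightarrow> represents (\<lambda>n. a n - b n) (f - g)"
  using represents_add[OF _ represents_scale[where c = "-1"], of a f b g]
  by (simp add: fun_scale_def fun_diff_def plus_fun_def)

lemma represents_const: "a \<in> S \<Longrightarrow> represents (\<lambda>n. a) (emb a)"
  using mem_0 ip_zero_left by (auto simp: represents_def Cauchy_in_def ip_norm_def)

text \<open>Convergence tested on the family \<open>k\<close> extends by conjugate linearity to its
  span, which contains \<open>b\<close>.\<close>

lemma ip_tendsto_0_if_emb_tendsto_0: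
  assumes a: "range a \<subseteq> S" and lim: "\<And>x. (\<lambda>n. emb (a n) x) \<longlonglongrightarrow> 0" and b: "b \<in> S"
  shows "(\<lambda>n. ip (a n) b) \<longlonglongrightarrow> 0"
proof -
  have aS: "a n \<in> S" for n using a by blast
  have "b \<in> span (range k)" using b span_k by blast
  \<comment> \<open>Membership in \<open>S\<close> is carried through the induction because the laws
    of \<open>ip\<close> hold only there.\<close>
  then have "b \<in> S \<and> (\<lambda>n. ip (a n) b) \<longlonglongrightarrow> 0"
  proof (induction rule: span_induct_alt)
    case base
    have "ip (a n) 0 = 0" for n using ip_scale_right[of 0 "a n" 0] mem_0 aS by simp
    then show ?case using mem_0 by simp
  next
    case (step c x y)
    then obtain t where t: "x = k t" by blast
    have y: "y \<in> S" and IH: "(\<lambda>n. ip (a n) y) \<longlonglongrightarrow> 0" using step(2) by auto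
    have "ip (a n) (scl c x + y) = cnj c * emb (a n) t + ip (a n) y" for n
      using aS y k_mem by (simp add: t ip_add_right ip_scale_right mem_scale emb_def)
    then show ?case
      using tendsto_add[OF tendsto_mult[OF tendsto_const lim] IH] k_mem y
      by (simp add: t mem_add mem_scale)
  qed
  then show ?thesis ..
qed

text \<open>
  Hence the limit of inner products depends only on the limit functions, not on the representing
  sequences.
\<close>

lemma ip_tendsto_0_if_represents_0:
  assumes a: "represents a 0" and b: "Cauchy_in b"
  shows "(\<lambda>n. ip (a n) (b n)) \<longlonglongrightarrow> 0"
proof (rule tendsto_norm_zero_cancel, rule LIMSEQ_I)
  fix e :: real assume e: "e > 0"
  have Ca: "Cauchy_in a" using a by (simp add: represents_def)
  have aS: "a n \<in> S" and bS: "b n \<in> S" for n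
    using Ca b by (auto intro: Cauchy_in_mem)
  obtain B where B: "B > 0" "\<And>n. ip_norm ip (a n) \<le> B" using Cauchy_in_bounded[OF Ca] by blast
  \<comment> \<open>The second argument is frozen at \<open>b N\<close>: the remainder
    \<open>b n - b N\<close> is small against the bound \<open>B\<close> on the first argument, and
    the fixed vector \<open>b N\<close> falls under the preceding lemma.\<close>
  obtain N where N: "\<And>m n. \<lbrakk>m \<ge> N; n \<ge> N\<rbrakk> \<Longrightarrow> ip_norm ip (b m - b n) < e / (2 * B)"
    using b e B unfolding Cauchy_in_def by (meson divide_pos_pos mult_pos_pos zero_less_numeral)
  have "(\<lambda>n. ip (a n) (b N)) \<longlonglongrightarrow> 0"
    using a bS aS by (intro ip_tendsto_0_if_emb_tendsto_0) (auto simp: represents_def)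
  then obtain M where M: "\<And>n. n \<ge> M \<Longrightarrow> cmod (ip (a n) (b N)) < e / 2"
    using LIMSEQ_D[of _ 0 "e/2"] e by fastforce
  have "cmod (ip (a n) (b n)) < e" if n: "n \<ge> max N M" for n
  proof -
    have "ip (a n) (b n) = ip (a n) (b n - b N) + ip (a n) (b N)"
      using aS bS by (simp add: ip_diff_right)
    then have "cmod (ip (a n) (b n)) \<le> cmod (ip (a n) (b n - b N)) + cmod (ip (a n) (b N))"
      using norm_triangle_ineq by metis
    moreover have "cmod (ip (a n) (b n - b N)) \<le> ip_norm ip (a n) * ip_norm ip (b n - b N)"
      using aS bS by (simp add: cmod_ip_le mem_diff)
    moreover have "\<dots> \<le> B * (e / (2 * B))"
      using B N[of n N] n aS bS by (intro mult_mono) (auto simp: ip_norm_nonneg mem_diff)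
    moreover have "B * (e / (2 * B)) = e / 2" using B by simp
    ultimately show ?thesis using M[of n] n by simp
  qed
  then show "\<exists>no. \<forall>n\<ge>no. norm (norm (ip (a n) (b n)) - 0) < e"
    by (intro exI[of _ "max N M"]) simp
qed

lemma convergent_ip:
  assumes a: "Cauchy_in a" and b: "Cauchy_in b"
  shows "convergent (\<lambda>n. ip (a n) (b n))"
proof -
  have aS: "a n \<in> S" and bS: "b n \<in> S" for n
    using a b by (auto intro: Cauchy_in_mem)
  obtain A where A: "A > 0" "\<And>n. ip_norm ip (a n) \<le> A" using Cauchy_in_bounded[OF a] by blast
  obtain B where B: "B > 0" "\<And>n. ip_norm ip (b n) \<le> B" using Cauchy_in_bounded[OF b] by blast
  have "Cauchy (\<lambda>n. ip (a n) (b n))"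
  proof (rule CauchyI)
    fix e :: real assume e: "e > 0"
    obtain N where N: "\<And>m n. \<lbrakk>m \<ge> N; n \<ge> N\<rbrakk> \<Longrightarrow> ip_norm ip (b m - b n) < e / (2 * A)"
      using b e A unfolding Cauchy_in_def by (meson divide_pos_pos mult_pos_pos zero_less_numeral)
    obtain M where M: "\<And>m n. \<lbrakk>m \<ge> M; n \<ge> M\<rbrakk> \<Longrightarrow> ip_norm ip (a m - a n) < e / (2 * B)"
      using a e B unfolding Cauchy_in_def by (meson divide_pos_pos mult_pos_pos zero_less_numeral)
    have "cmod (ip (a m) (b m) - ip (a n) (b n)) < e" if mn: "m \<ge> max N M" "n \<ge> max N M" for m n
    proof -
      have "ip (a m) (b m) - ip (a n) (b n) = ip (a m) (b m - b n) + ip (a m - a n) (b n)"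
        using aS bS by (simp add: ip_diff_right ip_diff_left)
      then have "cmod (ip (a m) (b m) - ip (a n) (b n))
          \<le> cmod (ip (a m) (b m - b n)) + cmod (ip (a m - a n) (b n))"
        using norm_triangle_ineq by metis
      also have "\<dots> \<le> ip_norm ip (a m) * ip_norm ip (b m - b n) + ip_norm ip (a m - a n) * ip_norm ip (b n)"
        using aS bS by (intro add_mono cmod_ip_le mem_diff)
      also have "\<dots> \<le> A * ip_norm ip (b m - b n) + ip_norm ip (a m - a n) * B"
        using A B aS bS by (intro add_mono mult_right_mono mult_left_mono ip_norm_nonneg mem_diff)
      also have "\<dots> < A * (e / (2 * A)) + e / (2 * B) * B"
        using A B N[of m n] M[of m n] mn
        by (intro add_strict_mono mult_strict_left_mono mult_strict_right_mono) auto
      also have "\<dots> = e" using A B by simp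
      finally show ?thesis .
    qed
    then show "\<exists>M. \<forall>m\<ge>M. \<forall>n\<ge>M. norm (ip (a m) (b m) - ip (a n) (b n)) < e" by blast
  qed
  then show ?thesis by (rule Cauchy_convergent)
qed

section \<open>The inner product of limit functions\<close>

lemma represents_SOME: "f \<in> compl \<Longrightarrow> represents (SOME a. represents a f) f"
  unfolding compl_def by (auto intro: someI[of "\<lambda>a. represents a f"])

text \<open>Two sequences representing the same function differ by one representing 0. Exchanging
  the chosen sequences for \<open>a\<close> and \<open>b\<close> one slot at a time thus changes the
  products by null sequences; hermitian symmetry moves the second slot to the first.\<close>

lemma ip_tendsto_compl_ip:
  assumes a: "represents a f" and b: "represents b g"
  shows "(\<lambda>n. ip (a n) (b n)) \<longlonglongrightarrow> compl_ip f g"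
proof -
  let ?a = "SOME a. represents a f" and ?b = "SOME b. represents b g"
  have a': "represents ?a f" and b': "represents ?b g"
    using a b represents_SOME by (auto simp: compl_def)
  have C: "Cauchy_in a" "Cauchy_in b" "Cauchy_in ?a" "Cauchy_in ?b"
    using a b a' b' by (auto simp: represents_def)
  have mem: "a n \<in> S" "b n \<in> S" "?a n \<in> S" "?b n \<in> S" for n
    using C by (auto intro: Cauchy_in_mem)
  have "(\<lambda>n. ip (?a n) (?b n)) \<longlonglongrightarrow> compl_ip f g"
    unfolding compl_ip_def using convergent_ip[OF C(3,4)] by (simp add: convergent_LIMSEQ_iff)
  moreover have "(\<lambda>n. ip (a n - ?a n) (b n)) \<longlonglongrightarrow> 0"
    using represents_diff[OF a a'] C by (intro ip_tendsto_0_if_represents_0) auto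
  moreover have "(\<lambda>n. ip (b n - ?b n) (?a n)) \<longlonglongrightarrow> 0"
    using represents_diff[OF b b'] C by (intro ip_tendsto_0_if_represents_0) auto
  then have "(\<lambda>n. cnj (ip (b n - ?b n) (?a n))) \<longlonglongrightarrow> cnj 0"
    by (rule tendsto_cnj)
  ultimately have "(\<lambda>n. ip (?a n) (?b n) + ip (a n - ?a n) (b n) + cnj (ip (b n - ?b n) (?a n)))
      \<longlonglongrightarrow> compl_ip f g + 0 + cnj 0"
    by (intro tendsto_add)
  moreover have "ip (?a n) (?b n) + ip (a n - ?a n) (b n) + cnj (ip (b n - ?b n) (?a n)) = ip (a n) (b n)"
    for n
  proof -
    have "cnj (ip (b n - ?b n) (?a n)) = ip (?a n) (b n - ?b n)"
      using mem[of n] by (intro ip_hermitian[symmetric] mem_diff)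
    then show ?thesis using mem[of n] by (simp add: ip_diff_left ip_diff_right)
  qed
  ultimately show ?thesis by simp
qed

lemma compl_ipI:
  "\<lbrakk>represents a f; represents b g; (\<lambda>n. ip (a n) (b n)) \<longlonglongrightarrow> c\<rbrakk> \<Longrightarrow> compl_ip f g = c"
  using ip_tendsto_compl_ip LIMSEQ_unique by blast

lemma emb_mem: "a \<in> S \<Longrightarrow> emb a \<in> compl"
  using represents_const by (auto simp: compl_def)

lemma compl_ip_emb: "\<lbrakk>a \<in> S; b \<in> S\<rbrakk> \<Longrightarrow> compl_ip (emb a) (emb b) = ip a b"
  by (rule compl_ipI[OF represents_const represents_const]) auto

text \<open>The reproducing property: with the constant sequence \<open>k x\<close> on the right,
  the limit of inner products is the pointwise limit that defines \<open>f x\<close>.\<close>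

lemma compl_ip_emb_k: "f \<in> compl \<Longrightarrow> compl_ip f (emb (k x)) = f x"
  by (auto simp: compl_def represents_def emb_def
      intro!: compl_ipI[OF _ represents_const[OF k_mem]])

text \<open>The laws pass to limits along representing sequences, but strict positivity does not.
  Semidefiniteness comes first because its Cauchy-Schwarz inequality is what gives definiteness
  below.\<close>

sublocale completion: semi_inner_product_space fun_scale compl compl_ip
proof (intro semi_inner_product_space.intro indefinite_inner_product_space.intro
    indefinite_inner_product_space_axioms.intro semi_inner_product_space_axioms.intro
    vector_space_fun_scale)
  show "module.subspace fun_scale compl"
    using represents_add represents_scale represents_const[OF mem_0] emb_diff[OF mem_0 mem_0]
    by (auto simp: module.subspace_def[OF module_fun_scale] compl_def) metis+
  fix f g h c
  assume f: "f \<in> compl" and h: "h \<in> compl"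
  then obtain a b where a: "represents a f" and b: "represents b h"
    by (auto simp: compl_def)
  have mem: "a n \<in> S" "b n \<in> S" for n
    using a b by (auto simp: represents_def intro: Cauchy_in_mem)
  note lim = ip_tendsto_compl_ip[OF a b]
  show "compl_ip (fun_scale c f) h = c * compl_ip f h"
    using tendsto_mult[OF tendsto_const lim, of c] mem
    by (intro compl_ipI[OF represents_scale[OF a] b]) (simp add: ip_scale_left)
  show "compl_ip h f = cnj (compl_ip f h)"
  proof (intro compl_ipI[OF b a])
    have "ip (b n) (a n) = cnj (ip (a n) (b n))" for n using mem by (intro ip_hermitian)
    then show "(\<lambda>n. ip (b n) (a n)) \<longlonglongrightarrow> cnj (compl_ip f h)" using tendsto_cnj[OF lim] by simp
  qed
  show "compl_ip (f + g) h = compl_ip f h + compl_ip g h" if g: "g \<in> compl"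
  proof -
    obtain d where d: "represents d g" using g by (auto simp: compl_def)
    have "d n \<in> S" for n using d by (auto simp: represents_def intro: Cauchy_in_mem)
    then show ?thesis
      using tendsto_add[OF lim ip_tendsto_compl_ip[OF d b]] mem
      by (intro compl_ipI[OF represents_add[OF a d] b]) (simp add: ip_add_left)
  qed
next
  fix f assume "f \<in> compl"
  then obtain a where a: "represents a f" by (auto simp: compl_def)
  then have "0 \<le> Re (ip (a n) (a n))" for n
    by (auto simp: represents_def intro: Cauchy_in_mem ip_self_nonneg)
  then show "0 \<le> Re (compl_ip f f)"
    using tendsto_Re[OF ip_tendsto_compl_ip[OF a a]] LIMSEQ_le_const by blast
qed

text \<open>Point evaluations are bounded, by the reproducing property and Cauchy-Schwarz. Hence a
  function of norm 0 vanishes everywhere, which is definiteness.\<close>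

lemma cmod_eval_le: "f \<in> compl \<Longrightarrow> cmod (f x) \<le> ip_norm compl_ip f * ip_norm ip (k x)"
  using completion.cmod_ip_le[of f "emb (k x)"]
  by (simp add: compl_ip_emb_k emb_mem k_mem ip_norm_def) (simp add: emb_def)

sublocale completion: positive_inner_product_space fun_scale compl compl_ip
proof
  fix f assume f: "f \<in> compl" "f \<noteq> 0"
  have "ip_norm compl_ip f \<noteq> 0"
    using f cmod_eval_le[OF f(1)] by (auto simp: fun_eq_iff)
  then show "0 < Re (compl_ip f f)"
    using completion.ip_self_nonneg[OF f(1)] by (simp add: ip_norm_def)
qed

lemma represents_norm_le:
  assumes a: "represents a f" and le: "\<And>m. m \<ge> n \<Longrightarrow> ip_norm ip (a m - a n) \<le> e"
  shows "ip_norm compl_ip (f - emb (a n)) \<le> e"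
proof -
  have mem: "a n \<in> S" for n
    using a by (auto simp: represents_def intro: Cauchy_in_mem)
  have r: "represents (\<lambda>m. a m - a n) (f - emb (a n))"
    using represents_diff[OF a represents_const[OF mem]] .
  have "(\<lambda>m. ip_norm ip (a m - a n)) \<longlonglongrightarrow> ip_norm compl_ip (f - emb (a n))"
    unfolding ip_norm_def by (intro tendsto_real_sqrt tendsto_Re ip_tendsto_compl_ip r)
  then show ?thesis
    using le LIMSEQ_le_const2 by blast
qed

lemma represents_tendsto:
  assumes "represents a f" "e > 0"
  obtains N where "\<And>n. n \<ge> N \<Longrightarrow> ip_norm compl_ip (f - emb (a n)) < e"
proof -
  obtain N where N: "\<And>m n. \<lbrakk>m \<ge> N; n \<ge> N\<rbrakk> \<Longrightarrow> ip_norm ip (a m - a n) < e / 2"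
    using assms unfolding represents_def Cauchy_in_def by (meson half_gt_zero)
  have "ip_norm compl_ip (f - emb (a n)) \<le> e / 2" if "n \<ge> N" for n
    using N that by (intro represents_norm_le[OF assms(1)] less_imp_le) auto
  then show ?thesis using that assms(2) by force
qed

text \<open>Each \<open>F n\<close> is approximated within \<open>1 / Suc n\<close> by an embedded
  vector \<open>a n\<close>. The embedding is isometric, so \<open>a\<close> is Cauchy in the
  original space, and the function it represents is the limit of \<open>F\<close>.\<close>

sublocale completion: hilbert_space_on fun_scale compl compl_ip
proof
  interpret M: Metric_space compl "ip_dist compl compl_ip"
    by (rule completion.Metric_space_ip_dist)
  have dist: "ip_dist compl compl_ip f g = ip_norm compl_ip (f - g)" if "f \<in> compl" "g \<in> compl" for f g
    using that by (simp add: ip_dist_def)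
  show "Metric_space.mcomplete compl (ip_dist compl compl_ip)"
    unfolding M.mcomplete_def
  proof (intro allI impI)
    fix F assume F: "M.MCauchy F"
    have FS: "F n \<in> compl" for n using F by (auto simp: M.MCauchy_def)
    have "\<exists>a\<in>S. ip_norm compl_ip (F n - emb a) < 1 / Suc n" for n
    proof -
      obtain a where a: "represents a (F n)" using FS by (auto simp: compl_def)
      obtain N where "\<And>m. m \<ge> N \<Longrightarrow> ip_norm compl_ip (F n - emb (a m)) < 1 / Suc n"
        using represents_tendsto[OF a, of "1 / Suc n"] by auto
      then show ?thesis
        using a Cauchy_in_mem[of a N] by (auto simp: represents_def)
    qed
    then obtain a where aS: "\<And>n. a n \<in> S" and Fa: "\<And>n. ip_norm compl_ip (F n - emb (a n)) < 1 / Suc n"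
      by metis
    have small: "\<exists>N. \<forall>n\<ge>N. 1 / real (Suc n) < e" if "e > 0" for e
    proof -
      have "(\<lambda>n. 1 / real (Suc n)) \<longlonglongrightarrow> 0" by (rule lim_1_over_n[THEN LIMSEQ_Suc])
      then show ?thesis using LIMSEQ_D[of _ 0 e] that by fastforce
    qed
    have eS: "emb (a n) \<in> compl" for n using aS by (rule emb_mem)
    have Ca: "Cauchy_in a"
      unfolding Cauchy_in_def
    proof (intro conjI allI impI)
      fix e :: real assume e: "e > 0"
      then have "e / 3 > 0" by simp
      then obtain N M where N: "\<And>n. n \<ge> N \<Longrightarrow> 1 / real (Suc n) < e / 3"
        and M: "\<And>m n. \<lbrakk>m \<ge> M; n \<ge> M\<rbrakk> \<Longrightarrow> ip_norm compl_ip (F m - F n) < e / 3"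
        using small[OF \<open>e / 3 > 0\<close>] F dist FS unfolding M.MCauchy_def by metis
      have "ip_norm ip (a m - a n) < e" if "m \<ge> max M N" "n \<ge> max M N" for m n
      proof -
        have "ip_norm ip (a m - a n) = ip_norm compl_ip (emb (a m) - emb (a n))"
          using aS by (simp add: ip_norm_def compl_ip_emb mem_diff flip: emb_diff)
        also have "\<dots> \<le> ip_norm compl_ip (emb (a m) - F m) + ip_norm compl_ip (F m - emb (a n))"
          using eS FS by (intro completion.ip_norm_diff_triangle)
        also have "ip_norm compl_ip (F m - emb (a n)) \<le>
            ip_norm compl_ip (F m - F n) + ip_norm compl_ip (F n - emb (a n))"
          using eS FS by (intro completion.ip_norm_diff_triangle)
        also have "ip_norm compl_ip (emb (a m) - F m) = ip_norm compl_ip (F m - emb (a m))"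
          using eS FS by (intro completion.ip_norm_diff_commute)
        finally show ?thesis
          using Fa[of m] Fa[of n] N[of m] N[of n] M[of m n] that by linarith
      qed
      then show "\<exists>N. \<forall>m\<ge>N. \<forall>n\<ge>N. ip_norm ip (a m - a n) < e" by blast
    qed (use aS in auto)
    define f where "f x = lim (\<lambda>n. emb (a n) x)" for x
    \<comment> \<open>The values at \<open>x\<close> are inner products with the constant Cauchy
      sequence \<open>k x\<close>, so they converge.\<close>
    have "(\<lambda>n. emb (a n) x) \<longlonglongrightarrow> f x" for x
      using convergent_ip[OF Ca, of "\<lambda>_. k x"] represents_const[OF k_mem]
      unfolding f_def emb_def represents_def by (simp add: convergent_LIMSEQ_iff)
    then have f: "represents a f" using Ca by (simp add: represents_def)
    then have fS: "f \<in> compl" by (auto simp: compl_def)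
    have "\<forall>\<^sub>F n in sequentially. ip_norm compl_ip (F n - f) < e" if e: "e > 0" for e
    proof -
      have "e / 2 > 0" using e by simp
      then obtain N M where N: "\<And>n. n \<ge> N \<Longrightarrow> 1 / real (Suc n) < e / 2"
        and M: "\<And>n. n \<ge> M \<Longrightarrow> ip_norm compl_ip (f - emb (a n)) < e / 2"
        using small represents_tendsto[OF f] by metis
      have "ip_norm compl_ip (F n - f) < e" if "n \<ge> max M N" for n
        using completion.ip_norm_diff_triangle[OF FS eS fS, of n n] N[of n] M[of n] Fa[of n] that
          completion.ip_norm_diff_commute[OF eS fS, of n] by simp
      then show ?thesis unfolding eventually_sequentially by blast
    qed
    then have "limitin M.mtopology F f sequentially"
      using FS fS by (simp add: M.limitin_metric dist)
    then show "\<exists>f. limitin M.mtopology F f sequentially" by blast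
  qed
qed

end

section \<open>Positive semidefinite kernels\<close>

text \<open>Only the real part is constrained; hermitian symmetry is a separate assumption in
  \<open>reproducing_kernel\<close>, and together they make the form real and nonnegative.\<close>

definition psd_kernel :: "('x \<Rightarrow> 'x \<Rightarrow> complex) \<Rightarrow> bool" where
  "psd_kernel L \<longleftrightarrow>
     (\<forall>F a. finite F \<longrightarrow> 0 \<le> Re (\<Sum>x\<in>F. \<Sum>y\<in>F. a x * cnj (a y) * L x y))"

lemma psd_kernel_const: "psd_kernel (\<lambda>x y. 1)"
  unfolding psd_kernel_def
proof (intro allI impI)
  fix F :: "'x set" and a :: "'x \<Rightarrow> complex"
  have "(\<Sum>x\<in>F. \<Sum>y\<in>F. a x * cnj (a y) * 1) = (\<Sum>x\<in>F. a x) * cnj (\<Sum>x\<in>F. a x)"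
    by (simp add: sum_product)
  then show "0 \<le> Re (\<Sum>x\<in>F. \<Sum>y\<in>F. a x * cnj (a y) * 1)"
    by (simp only: complex_mult_cnj Re_complex_of_real) simp
qed

lemma psd_kernel_add: "\<lbrakk>psd_kernel L; psd_kernel M\<rbrakk> \<Longrightarrow> psd_kernel (\<lambda>x y. L x y + M x y)"
  by (simp add: psd_kernel_def distrib_left sum.distrib)

lemma psd_kernel_scale: "\<lbrakk>psd_kernel L; 0 \<le> r\<rbrakk> \<Longrightarrow> psd_kernel (\<lambda>x y. of_real r * L x y)"
proof -
  assume L: "psd_kernel L" and r: "0 \<le> r"
  have "(\<Sum>x\<in>F. \<Sum>y\<in>F. a x * cnj (a y) * (of_real r * L x y))
      = of_real r * (\<Sum>x\<in>F. \<Sum>y\<in>F. a x * cnj (a y) * L x y)" for F a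
    by (simp add: sum_distrib_left mult_ac)
  then show ?thesis using L r by (simp add: psd_kernel_def del: Re_sum)
qed

lemma psd_kernel_sum: "(\<And>i. i < n \<Longrightarrow> psd_kernel (L i)) \<Longrightarrow> psd_kernel (\<lambda>x y. \<Sum>i<(n::nat). L i x y)"
proof (induction n)
  case 0
  then show ?case by (simp add: psd_kernel_def)
next
  case (Suc n)
  then show ?case by (simp add: psd_kernel_add)
qed

lemma psd_kernel_limit:
  assumes "\<And>n. psd_kernel (L n)" and "\<And>x y. (\<lambda>n. L n x y) \<longlonglongrightarrow> M x y"
  shows "psd_kernel M"
  unfolding psd_kernel_def
proof (intro allI impI)
  fix F :: "'a set" and a :: "'a \<Rightarrow> complex"
  assume "finite F"
  then have "0 \<le> Re (\<Sum>x\<in>F. \<Sum>y\<in>F. a x * cnj (a y) * L n x y)" for n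
    using assms(1) unfolding psd_kernel_def by blast
  moreover have "(\<lambda>n. Re (\<Sum>x\<in>F. \<Sum>y\<in>F. a x * cnj (a y) * L n x y))
      \<longlonglongrightarrow> Re (\<Sum>x\<in>F. \<Sum>y\<in>F. a x * cnj (a y) * M x y)"
    by (intro tendsto_Re tendsto_sum tendsto_mult tendsto_const assms)
  ultimately show "0 \<le> Re (\<Sum>x\<in>F. \<Sum>y\<in>F. a x * cnj (a y) * M x y)"
    using LIMSEQ_le_const by blast
qed

section \<open>Finite orthonormal expansions and exponentials of Gram kernels\<close>

context positive_inner_product_space
begin

lemma ip_sum_left:
  assumes "\<And>i. i \<in> I \<Longrightarrow> f i \<in> S" "y \<in> S"
  shows "ip (sum f I) y = (\<Sum>i\<in>I. ip (f i) y)"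
  using assms
proof (induction I rule: infinite_finite_induct)
  case (insert i I)
  then show ?case using subspace_sum[OF subspace_S, of I f] by (simp add: ip_add_left)
qed (simp_all add: ip_zero_left)

text \<open>Gram-Schmidt by induction on \<open>F\<close>: the residual of the new vector is
  normalised and adjoined unless it vanishes. The expansion is claimed against all \<open>y\<close>
  in \<open>S\<close>, so that it can be applied to the newly created unit vector.\<close>

lemma ex_finite_parseval:
  assumes "finite F" "F \<subseteq> S"
  shows "\<exists>E\<subseteq>S. finite E \<and> (\<forall>e\<in>E. \<forall>e'\<in>E. ip e e' = (if e = e' then 1 else 0)) \<and>
    (\<forall>x\<in>F. \<forall>y\<in>S. ip x y = (\<Sum>e\<in>E. ip x e * ip e y))"
  using assms
proof (induction F rule: finite_induct)
  case empty
  then show ?case by (intro exI[of _ "{}"]) auto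
next
  case (insert z F)
  then have z: "z \<in> S" by simp
  obtain E where E: "E \<subseteq> S" "finite E" "\<forall>e\<in>E. \<forall>e'\<in>E. ip e e' = (if e = e' then 1 else 0)"
      "\<forall>x\<in>F. \<forall>y\<in>S. ip x y = (\<Sum>e\<in>E. ip x e * ip e y)"
    using insert by auto
  define r where "r = z - (\<Sum>e\<in>E. scl (ip z e) e)"
  have sS: "(\<Sum>e\<in>E. scl (ip z e) e) \<in> S"
    using E(1) by (intro subspace_sum[OF subspace_S] mem_scale) auto
  have rS: "r \<in> S" unfolding r_def using z sS by (rule mem_diff)
  have ip_r: "ip r y = ip z y - (\<Sum>e\<in>E. ip z e * ip e y)" if y: "y \<in> S" for y
  proof -
    have "ip (\<Sum>e\<in>E. scl (ip z e) e) y = (\<Sum>e\<in>E. ip (scl (ip z e) e) y)"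
      using E(1) y by (intro ip_sum_left mem_scale) auto
    also have "\<dots> = (\<Sum>e\<in>E. ip z e * ip e y)"
      using E(1) y by (intro sum.cong refl ip_scale_left) auto
    finally show ?thesis unfolding r_def using z sS y by (simp add: ip_diff_left)
  qed
  have r_orth: "ip r e = 0" if e: "e \<in> E" for e
  proof -
    have "(\<Sum>e'\<in>E. ip z e' * ip e' e) = (\<Sum>e'\<in>E. if e' = e then ip z e' else 0)"
      using E(3) e by (intro sum.cong) auto
    then show ?thesis using ip_r[of e] e E(1,2) by auto
  qed
  show ?case
  proof (cases "r = 0")
    case True
    then have "ip z y = (\<Sum>e\<in>E. ip z e * ip e y)" if "y \<in> S" for y
      using ip_r[OF that] ip_zero_left[OF that] True by simp
    then show ?thesis using E by (intro exI[of _ E]) blast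
  next
    case False
    define n where "n = ip_norm ip r"
    have n: "n > 0" using ip_pos[OF rS False] by (simp add: n_def ip_norm_def)
    have rr: "ip r r = of_real (n\<^sup>2)"
      using ip_norm_power2[OF rS] ip_self_real[OF rS] by (simp add: complex_eq_iff n_def)
    define u where "u = scl (of_real (1 / n)) r"
    have uS: "u \<in> S" unfolding u_def using rS by (rule mem_scale)
    have u_left: "ip u y = of_real (1 / n) * ip r y" if "y \<in> S" for y
      unfolding u_def using rS that by (intro ip_scale_left)
    have u_right: "ip y u = of_real (1 / n) * ip y r" if "y \<in> S" for y
      unfolding u_def using rS that by (simp add: ip_scale_right)
    have uu: "ip u u = 1"
      using u_left[OF uS] u_right[OF rS] rr n by (simp add: power2_eq_square)
    have ue: "ip u e = 0" "ip e u = 0" if e: "e \<in> E" for e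
    proof -
      have eS: "e \<in> S" using e E by auto
      then show "ip u e = 0" using u_left r_orth[OF e] by simp
      then show "ip e u = 0" using ip_hermitian[OF uS eS] by simp
    qed
    have uE: "u \<notin> E" using ue(1) uu by auto
    \<comment> \<open>The projected part of \<open>z\<close> is orthogonal to \<open>u\<close>, so
      the new coefficient is the norm of the residual.\<close>
    have zu: "ip z u = of_real n"
    proof -
      have "ip r u = ip z u - (\<Sum>e\<in>E. ip z e * ip e u)" using uS by (rule ip_r)
      then have "ip z u = ip r u" using ue by simp
      then show ?thesis using u_right[OF rS] rr n by (simp add: power2_eq_square)
    qed
    have "ip z y = (\<Sum>e\<in>insert u E. ip z e * ip e y)" if y: "y \<in> S" for y
      using ip_r[OF y] u_left[OF y] uE E(2) zu n by simp
    moreover have "ip x y = (\<Sum>e\<in>insert u E. ip x e * ip e y)" if x: "x \<in> F" and y: "y \<in> S" for x y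
    proof -
      \<comment> \<open>Expanding an old vector along \<open>E\<close> and testing against
        \<open>u\<close> shows that its new coefficient is 0.\<close>
      have "ip x u = (\<Sum>e\<in>E. ip x e * ip e u)" using E(4) x uS by blast
      then have "ip x u = 0" using ue by simp
      moreover have "ip x y = (\<Sum>e\<in>E. ip x e * ip e y)" using E(4) x y by blast
      ultimately show ?thesis using E(2) uE by simp
    qed
    ultimately have "\<forall>x\<in>insert z F. \<forall>y\<in>S. ip x y = (\<Sum>e\<in>insert u E. ip x e * ip e y)"
      by blast
    moreover have "\<forall>e\<in>insert u E. \<forall>e'\<in>insert u E. ip e e' = (if e = e' then 1 else 0)"
      using E(3) uu ue uE by auto
    ultimately show ?thesis
      using E(1,2) uS by (intro exI[of _ "insert u E"]) blast
  qed
qed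

text \<open>
  A case of Schur's product theorem: expanding \<open>ip\<close> along a finite orthonormal set turns the
  product into a sum of diagonal rescalings of \<open>M\<close>.
\<close>

lemma psd_kernel_ip_mult:
  fixes \<phi> :: "'x \<Rightarrow> _"
  assumes M: "psd_kernel M" and \<phi>: "range \<phi> \<subseteq> S"
  shows "psd_kernel (\<lambda>x y. ip (\<phi> x) (\<phi> y) * M x y)"
  unfolding psd_kernel_def
proof (intro allI impI)
  fix F :: "'x set" and a :: "'x \<Rightarrow> complex"
  assume F: "finite F"
  have \<phi>S: "\<phi> x \<in> S" for x using \<phi> by blast
  then have "\<phi> ` F \<subseteq> S" by blast
  from ex_finite_parseval[OF finite_imageI[OF F] this] obtain E where E: "E \<subseteq> S" "\<forall>x\<in>\<phi> ` F. \<forall>y\<in>S. ip x y = (\<Sum>e\<in>E. ip x e * ip e y)"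
    by (elim exE conjE) (rule that)
  define q where "q e = (\<Sum>x\<in>F. \<Sum>y\<in>F. (a x * ip (\<phi> x) e) * cnj (a y * ip (\<phi> y) e) * M x y)" for e
  have "a x * cnj (a y) * (ip (\<phi> x) (\<phi> y) * M x y)
      = (\<Sum>e\<in>E. (a x * ip (\<phi> x) e) * cnj (a y * ip (\<phi> y) e) * M x y)" if "x \<in> F" "y \<in> F" for x y
  proof -
    have "ip (\<phi> x) (\<phi> y) = (\<Sum>e\<in>E. ip (\<phi> x) e * ip e (\<phi> y))" using E(2) imageI[OF that(1), of \<phi>] \<phi>S by blast
    also have "\<dots> = (\<Sum>e\<in>E. ip (\<phi> x) e * cnj (ip (\<phi> y) e))"
    proof (intro sum.cong refl)
      fix e assume "e \<in> E"
      then have "ip e (\<phi> y) = cnj (ip (\<phi> y) e)" using E(1) \<phi>S by (intro ip_hermitian) auto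
      then show "ip (\<phi> x) e * ip e (\<phi> y) = ip (\<phi> x) e * cnj (ip (\<phi> y) e)" by simp
    qed
    finally show ?thesis by (simp add: sum_distrib_left sum_distrib_right mult_ac)
  qed
  then have "(\<Sum>x\<in>F. \<Sum>y\<in>F. a x * cnj (a y) * (ip (\<phi> x) (\<phi> y) * M x y))
      = (\<Sum>x\<in>F. \<Sum>y\<in>F. \<Sum>e\<in>E. (a x * ip (\<phi> x) e) * cnj (a y * ip (\<phi> y) e) * M x y)"
    by (intro sum.cong) auto
  also have "\<dots> = (\<Sum>x\<in>F. \<Sum>e\<in>E. \<Sum>y\<in>F. (a x * ip (\<phi> x) e) * cnj (a y * ip (\<phi> y) e) * M x y)"
    by (intro sum.cong refl sum.swap)
  also have "\<dots> = (\<Sum>e\<in>E. q e)"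
    unfolding q_def by (rule sum.swap)
  also have "0 \<le> Re \<dots>"
    unfolding Re_sum[of q]
  proof (rule sum_nonneg)
    show "0 \<le> Re (q e)" for e
      using M[unfolded psd_kernel_def, rule_format, OF F, of "\<lambda>x. a x * ip (\<phi> x) e"]
      by (simp only: q_def)
  qed
  finally show "0 \<le> Re (\<Sum>x\<in>F. \<Sum>y\<in>F. a x * cnj (a y) * (ip (\<phi> x) (\<phi> y) * M x y))" .
qed

text \<open>Powers of the Gram kernel are positive semidefinite by repeated Schur products. The
  exponential is a pointwise limit of combinations of them with the nonnegative coefficients
  \<open>t ^ i / fact i\<close>.\<close>

lemma psd_kernel_exp_ip:
  assumes \<phi>: "range \<phi> \<subseteq> S" and t: "0 \<le> t"
  shows "psd_kernel (\<lambda>x y. exp (of_real t * ip (\<phi> x) (\<phi> y)))"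
proof (rule psd_kernel_limit)
  have pow: "psd_kernel (\<lambda>x y. ip (\<phi> x) (\<phi> y) ^ n)" for n
    by (induction n) (simp_all add: psd_kernel_const psd_kernel_ip_mult \<phi>)
  show "psd_kernel (\<lambda>x y. \<Sum>i<n. of_real (t ^ i / fact i) * ip (\<phi> x) (\<phi> y) ^ i)" for n
    using t by (intro psd_kernel_sum psd_kernel_scale pow) simp
  show "(\<lambda>n. \<Sum>i<n. of_real (t ^ i / fact i) * ip (\<phi> x) (\<phi> y) ^ i)
      \<longlonglongrightarrow> exp (of_real t * ip (\<phi> x) (\<phi> y))" for x y
    using exp_converges[of "of_real t * ip (\<phi> x) (\<phi> y)"]
    by (simp add: sums_def power_mult_distrib scaleR_conv_of_real divide_inverse mult_ac)
qed

end

section \<open>Reproducing kernel Hilbert spaces\<close>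

text \<open>The free vector space on the points: \<open>a\<close> stands for the formal combination
  of kernel functions with coefficients \<open>a x\<close>, and \<open>coeff_ip\<close> is its Gram
  form.\<close>

definition finite_support :: "('x \<Rightarrow> complex) set" where
  "finite_support = {a. finite {x. a x \<noteq> 0}}"

definition delta :: "'x \<Rightarrow> 'x \<Rightarrow> complex" where
  "delta x = (\<lambda>y. if y = x then 1 else 0)"

definition coeff_ip ::
  "('x \<Rightarrow> 'x \<Rightarrow> complex) \<Rightarrow> ('x \<Rightarrow> complex) \<Rightarrow> ('x \<Rightarrow> complex) \<Rightarrow> complex" where
  "coeff_ip L a b = (\<Sum>x | a x \<noteq> 0. \<Sum>y | b y \<noteq> 0. a x * cnj (b y) * L x y)"

text \<open>Enlarging the supports allows common index sets, as additivity and reindexing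
  require.\<close>

lemma coeff_ip_eq:
  assumes "finite F" "finite G" "{x. a x \<noteq> 0} \<subseteq> F" "{y. b y \<noteq> 0} \<subseteq> G"
  shows "coeff_ip L a b = (\<Sum>x\<in>F. \<Sum>y\<in>G. a x * cnj (b y) * L x y)"
proof -
  have "(\<Sum>y | b y \<noteq> 0. a x * cnj (b y) * L x y) = (\<Sum>y\<in>G. a x * cnj (b y) * L x y)" for x
    using assms by (intro sum.mono_neutral_left) auto
  then show ?thesis
    unfolding coeff_ip_def using assms by (simp, intro sum.mono_neutral_left) auto
qed

lemma finite_support_mem [intro]: "finite F \<Longrightarrow> {x. a x \<noteq> 0} \<subseteq> F \<Longrightarrow> a \<in> finite_support"
  unfolding finite_support_def using finite_subset by blast

lemma delta_mem: "delta x \<in> finite_support"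
  by (rule finite_support_mem[of "{x}"]) (auto simp: delta_def)

lemma coeff_ip_delta: "coeff_ip L (delta x) (delta y) = L x y"
  by (subst coeff_ip_eq[of "{x}" "{y}"]) (auto simp: delta_def)

locale reproducing_kernel =
  fixes L :: "'x \<Rightarrow> 'x \<Rightarrow> complex"
  assumes hermitian: "L y x = cnj (L x y)"
    and psd: "psd_kernel L"
begin

sublocale coeff: semi_inner_product_space fun_scale finite_support "coeff_ip L"
proof (intro semi_inner_product_space.intro indefinite_inner_product_space.intro
    indefinite_inner_product_space_axioms.intro semi_inner_product_space_axioms.intro
    vector_space_fun_scale)
  have add: "a + b \<in> finite_support" if "a \<in> finite_support" "b \<in> finite_support"
    for a b :: "'x \<Rightarrow> complex"
    using that
    by (intro finite_support_mem[of "{x. a x \<noteq> 0} \<union> {x. b x \<noteq> 0}"]) (auto simp: finite_support_def)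
  have scale: "fun_scale c a \<in> finite_support" if "a \<in> finite_support" for a :: "'x \<Rightarrow> complex" and c
    using that
    by (intro finite_support_mem[of "{x. a x \<noteq> 0}"]) (auto simp: finite_support_def fun_scale_def)
  show "module.subspace fun_scale (finite_support :: ('x \<Rightarrow> complex) set)"
    using add scale by (auto simp: module.subspace_def[OF module_fun_scale] finite_support_def)
  fix a b d :: "'x \<Rightarrow> complex" and c
  assume a: "a \<in> finite_support" and d: "d \<in> finite_support"
  define F G where "F = {x. a x \<noteq> 0}" and "G = {x. d x \<noteq> 0}"
  have F: "finite F" "{x. a x \<noteq> 0} \<subseteq> F" and G: "finite G" "{x. d x \<noteq> 0} \<subseteq> G"
    using a d by (auto simp: F_def G_def finite_support_def)
  have ad: "coeff_ip L a d = (\<Sum>x\<in>F. \<Sum>y\<in>G. a x * cnj (d y) * L x y)"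
    using F G by (intro coeff_ip_eq)
  have da: "coeff_ip L d a = (\<Sum>x\<in>G. \<Sum>y\<in>F. d x * cnj (a y) * L x y)"
    using F G by (intro coeff_ip_eq)
  show "coeff_ip L (fun_scale c a) d = c * coeff_ip L a d"
  proof -
    have "coeff_ip L (fun_scale c a) d = (\<Sum>x\<in>F. \<Sum>y\<in>G. fun_scale c a x * cnj (d y) * L x y)"
      using F G by (intro coeff_ip_eq) (auto simp: fun_scale_def)
    then show ?thesis by (simp add: ad fun_scale_def sum_distrib_left mult_ac)
  qed
  show "coeff_ip L d a = cnj (coeff_ip L a d)"
  proof -
    have "cnj (coeff_ip L a d) = (\<Sum>x\<in>F. \<Sum>y\<in>G. d y * cnj (a x) * L y x)"
      using hermitian by (simp add: ad mult_ac flip: hermitian)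
    also have "\<dots> = coeff_ip L d a" unfolding da by (rule sum.swap)
    finally show ?thesis ..
  qed
  show "coeff_ip L (a + b) d = coeff_ip L a d + coeff_ip L b d" if b: "b \<in> finite_support"
  proof -
    define F' where "F' = F \<union> {x. b x \<noteq> 0}"
    have F': "finite F'" "{x. a x \<noteq> 0} \<subseteq> F'" "{x. b x \<noteq> 0} \<subseteq> F'" "{x. (a + b) x \<noteq> 0} \<subseteq> F'"
      using F b by (auto simp: F'_def finite_support_def)
    show ?thesis
      using F' G by (subst (1 2 3) coeff_ip_eq[of F' G]) (auto simp: sum.distrib algebra_simps)
  qed
next
  fix a :: "'x \<Rightarrow> complex" assume "a \<in> finite_support"
  then show "0 \<le> Re (coeff_ip L a a)"
    using psd unfolding psd_kernel_def finite_support_def coeff_ip_def by blast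
qed

text \<open>The Moore-Aronszajn construction: completing along the point masses
  \<open>delta x\<close> turns each of them into the kernel function \<open>L x\<close>.\<close>

sublocale function_completion fun_scale finite_support "coeff_ip L" delta
proof
  show "delta x \<in> finite_support" for x :: 'x by (rule delta_mem)
  show "(finite_support :: ('x \<Rightarrow> complex) set) \<subseteq> module.span fun_scale (range delta)"
  proof (rule subsetI)
    fix a :: "'x \<Rightarrow> complex" assume "a \<in> finite_support"
    then have F: "finite {x. a x \<noteq> 0}" by (simp add: finite_support_def)
    have "a y = (\<Sum>x | a x \<noteq> 0. fun_scale (a x) (delta x)) y" for y
    proof -
      have "(\<Sum>x | a x \<noteq> 0. fun_scale (a x) (delta x)) y = (\<Sum>x | a x \<noteq> 0. fun_scale (a x) (delta x) y)"
        by (induction rule: infinite_finite_induct) auto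
      also have "\<dots> = (\<Sum>x | a x \<noteq> 0. if y = x then a x else 0)"
        by (intro sum.cong) (auto simp: fun_scale_def delta_def)
      finally show ?thesis using F by simp
    qed
    then have "a = (\<Sum>x | a x \<noteq> 0. fun_scale (a x) (delta x))" by blast
    also have "\<dots> \<in> module.span fun_scale (range delta)"
      by (intro coeff.span_sum coeff.span_scale coeff.span_base) auto
    finally show "a \<in> module.span fun_scale (range delta)" .
  qed
qed

lemma emb_delta: "emb (delta x) = L x"
  by (simp add: fun_eq_iff emb_def coeff_ip_delta)

lemma kernel_mem: "L x \<in> compl"
  using emb_mem[OF delta_mem] by (simp add: emb_delta)

lemma compl_ip_kernel: "f \<in> compl \<Longrightarrow> compl_ip f (L x) = f x"
  using compl_ip_emb_k by (simp add: emb_delta)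

section \<open>Kernel-symmetric involutions and the Krein form they induce\<close>

context
  fixes \<tau> :: "'x \<Rightarrow> 'x"
  assumes involution: "\<tau> (\<tau> x) = x"
    and symmetric: "L (\<tau> x) y = L x (\<tau> y)"
begin

lemma comp_comp_\<tau>: "f \<circ> \<tau> \<circ> \<tau> = f"
  by (simp add: fun_eq_iff involution)

lemma finite_support_comp: "a \<in> finite_support \<Longrightarrow> a \<circ> \<tau> \<in> finite_support"
proof (rule finite_support_mem)
  assume "a \<in> finite_support"
  then show "finite (\<tau> ` {x. a x \<noteq> 0})" by (simp add: finite_support_def)
  show "{x. (a \<circ> \<tau>) x \<noteq> 0} \<subseteq> \<tau> ` {x. a x \<noteq> 0}"
    using involution by (auto simp: image_iff) metis
qed

lemma coeff_ip_comp:
  assumes a: "a \<in> finite_support" and b: "b \<in> finite_support"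
  shows "coeff_ip L (a \<circ> \<tau>) b = coeff_ip L a (b \<circ> \<tau>)"
proof -
  \<comment> \<open>Adjoining the supports of the composed functions makes \<open>F\<close> stable
    under \<open>\<tau>\<close>, so both sums can be reindexed over it.\<close>
  define F where "F = {x. a x \<noteq> 0} \<union> {x. b x \<noteq> 0} \<union> {x. (a \<circ> \<tau>) x \<noteq> 0} \<union> {x. (b \<circ> \<tau>) x \<noteq> 0}"
  have F: "finite F"
    using a b finite_support_comp[OF a] finite_support_comp[OF b] by (simp add: F_def finite_support_def)
  have bij: "bij_betw \<tau> F F"
    by (rule bij_betw_byWitness[where f' = \<tau>]) (auto simp: involution F_def)
  have "coeff_ip L (a \<circ> \<tau>) b = (\<Sum>x\<in>F. \<Sum>y\<in>F. a (\<tau> x) * cnj (b y) * L x y)"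
    using F by (subst coeff_ip_eq[of F F]) (auto simp: F_def)
  also have "\<dots> = (\<Sum>x\<in>F. \<Sum>y\<in>F. a (\<tau> x) * cnj (b y) * L (\<tau> (\<tau> x)) y)"
    by (simp add: involution)
  also have "\<dots> = (\<Sum>x\<in>F. \<Sum>y\<in>F. a x * cnj (b y) * L (\<tau> x) y)"
    by (rule sum.reindex_bij_betw[OF bij])
  also have "\<dots> = (\<Sum>x\<in>F. \<Sum>y\<in>F. a x * cnj (b (\<tau> (\<tau> y))) * L x (\<tau> y))"
    by (simp add: involution symmetric)
  also have "\<dots> = (\<Sum>x\<in>F. \<Sum>y\<in>F. a x * cnj (b (\<tau> y)) * L x y)"
    by (intro sum.cong refl sum.reindex_bij_betw[OF bij])
  also have "\<dots> = coeff_ip L a (b \<circ> \<tau>)"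
    using F by (subst coeff_ip_eq[of F F]) (auto simp: F_def)
  finally show ?thesis .
qed

text \<open>Composition with \<open>\<tau>\<close> is a self-adjoint involution for the Gram form,
  hence isometric, and preserves Cauchy sequences. As it sends \<open>delta x\<close> to
  \<open>delta (\<tau> x)\<close>, its action on coefficients becomes composition on limit
  functions.\<close>

lemma represents_comp:
  assumes a: "represents a f"
  shows "represents (\<lambda>n. a n \<circ> \<tau>) (f \<circ> \<tau>)"
proof -
  have mem: "a n \<in> finite_support" for n
    using a by (auto simp: represents_def intro: Cauchy_in_mem)
  have norm: "ip_norm (coeff_ip L) ((a m \<circ> \<tau>) - (a n \<circ> \<tau>)) = ip_norm (coeff_ip L) (a m - a n)" for m n
  proof -
    have "(a m \<circ> \<tau>) - (a n \<circ> \<tau>) = (a m - a n) \<circ> \<tau>" by auto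
    then show ?thesis
      using mem by (simp add: ip_norm_def coeff_ip_comp coeff.mem_diff finite_support_comp comp_comp_\<tau>)
  qed
  have "emb (a n \<circ> \<tau>) x = emb (a n) (\<tau> x)" for n x
  proof -
    have "delta x \<circ> \<tau> = delta (\<tau> x)"
      using involution by (auto simp: delta_def fun_eq_iff)
    then show ?thesis by (simp add: emb_def coeff_ip_comp mem delta_mem)
  qed
  then show ?thesis
    using a by (auto simp: represents_def Cauchy_in_def norm finite_support_comp image_subset_iff)
qed

lemma compl_comp: "f \<in> compl \<Longrightarrow> f \<circ> \<tau> \<in> compl"
  using represents_comp by (auto simp: compl_def)

lemma compl_ip_comp:
  assumes "f \<in> compl" "g \<in> compl"
  shows "compl_ip (f \<circ> \<tau>) g = compl_ip f (g \<circ> \<tau>)"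
proof -
  obtain a b where a: "represents a f" and b: "represents b g"
    using assms by (auto simp: compl_def)
  have mem: "a n \<in> finite_support" "b n \<in> finite_support" for n
    using a b by (auto simp: represents_def intro: Cauchy_in_mem)
  show ?thesis
    using ip_tendsto_compl_ip[OF a represents_comp[OF b]] mem
    by (intro compl_ipI[OF represents_comp[OF a] b]) (simp add: coeff_ip_comp)
qed

lemma fundamental_symmetry_comp:
  "fundamental_symmetry fun_scale compl (\<lambda>f g. compl_ip (f \<circ> \<tau>) g) compl_ip (\<lambda>f. f \<circ> \<tau>)"
  unfolding fundamental_symmetry_def linear_on_subspace_def
  using completion.hilbert_space_on_axioms compl_comp compl_ip_comp
  by (auto simp: comp_comp_\<tau> fun_scale_def)

lemma krein_space_comp: "krein_space fun_scale compl (\<lambda>f g. compl_ip (f \<circ> \<tau>) g)"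
proof (intro krein_space.intro indefinite_inner_product_space.intro
    indefinite_inner_product_space_axioms.intro krein_space_axioms.intro
    vector_space_fun_scale completion.subspace_S)
  fix f g h c assume f: "f \<in> compl" and h: "h \<in> compl"
  note mem = f h compl_comp[OF f] compl_comp[OF h]
  have "fun_scale c f \<circ> \<tau> = fun_scale c (f \<circ> \<tau>)" by (auto simp: fun_scale_def)
  then show "compl_ip (fun_scale c f \<circ> \<tau>) h = c * compl_ip (f \<circ> \<tau>) h"
    using mem by (simp add: completion.ip_scale_left)
  show "compl_ip (h \<circ> \<tau>) f = cnj (compl_ip (f \<circ> \<tau>) h)"
    using mem completion.ip_hermitian[of "f \<circ> \<tau>" h] by (simp add: compl_ip_comp)
  show "compl_ip ((f + g) \<circ> \<tau>) h = compl_ip (f \<circ> \<tau>) h + compl_ip (g \<circ> \<tau>) h" if "g \<in> compl"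
  proof -
    have "(f + g) \<circ> \<tau> = (f \<circ> \<tau>) + (g \<circ> \<tau>)" by auto
    then show ?thesis using mem compl_comp[OF that] by (simp add: completion.ip_add_left)
  qed
next
  show "\<exists>hip J. fundamental_symmetry fun_scale compl (\<lambda>f g. compl_ip (f \<circ> \<tau>) g) hip J"
    using fundamental_symmetry_comp by blast
qed

end

end

section \<open>The Weyl commutation relations\<close>

locale weyl_kernel =
  fixes scl :: "complex \<Rightarrow> 'h::ab_group_add \<Rightarrow> 'h" and ip hip :: "'h \<Rightarrow> 'h \<Rightarrow> complex" and J
  assumes krein: "krein_space scl UNIV ip"
    and fund: "fundamental_symmetry scl UNIV ip hip J"
begin

sublocale H: krein_space scl UNIV ip
  by (rule krein)

sublocale HH: hilbert_space_on scl UNIV hip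
  using fund by (simp add: fundamental_symmetry_def)

lemma J_add: "J (x + y) = J x + J y"
  and J_J: "J (J x) = x"
  and hip_J: "hip (J x) y = hip x (J y)"
  and ip_eq_left: "ip x y = hip (J x) y"
  using fund by (auto simp: fundamental_symmetry_def linear_on_subspace_def)

lemma ip_eq: "ip x y = hip x (J y)"
  by (simp add: ip_eq_left hip_J)

section \<open>The Fock space and its Krein form\<close>

definition L :: "'h \<Rightarrow> 'h \<Rightarrow> complex" where
  "L x y = exp (hip x y / 2)"

sublocale reproducing_kernel L
proof
  show "L y x = cnj (L x y)" for x y
    using HH.ip_hermitian[of x y] by (simp add: L_def exp_cnj)
  show "psd_kernel L"
    using HH.psd_kernel_exp_ip[of "\<lambda>x. x" "1/2"] by (simp add: L_def[abs_def])
qed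

lemma L_J: "L (J x) y = L x (J y)"
  by (simp add: L_def hip_J)

text \<open>Composition with \<open>J\<close> is the second quantisation of \<open>J\<close>; on
  kernel functions it replaces \<open>exp (hip x y / 2)\<close> by
  \<open>exp (ip x y / 2)\<close>.\<close>

definition kip :: "('h \<Rightarrow> complex) \<Rightarrow> ('h \<Rightarrow> complex) \<Rightarrow> complex" where
  "kip f g = compl_ip (f \<circ> J) g"

sublocale K: krein_space fun_scale compl kip
  using krein_space_comp[of J, OF J_J L_J] by (simp add: kip_def[abs_def])

lemma kip_L: "f \<in> compl \<Longrightarrow> kip f (L x) = f (J x)"
  using compl_comp[of J f, OF J_J L_J] by (simp add: kip_def compl_ip_kernel)

section \<open>The Kolmogorov decomposition by rescaled kernel functions\<close>

definition g :: "'h \<Rightarrow> complex" where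
  "g \<xi> = exp (- (ip \<xi> \<xi> / 4))"

definition V :: "'h \<Rightarrow> complex \<Rightarrow> 'h \<Rightarrow> complex" where
  "V \<xi> z = fun_scale (z * g \<xi>) (L \<xi>)"

abbreviation D :: "('h \<Rightarrow> complex) set" where
  "D \<equiv> range_span fun_scale V"

lemma cnj_g: "cnj (g \<xi>) = g \<xi>"
  using H.ip_hermitian[of \<xi> \<xi>] by (simp add: g_def exp_cnj)

lemma V_mem: "V \<xi> z \<in> compl"
  unfolding V_def by (intro completion.mem_scale kernel_mem)

lemma V_mem_D: "V \<xi> z \<in> D"
  unfolding range_span_def by (rule coeff.span_base) auto

lemma subspace_D: "module.subspace fun_scale D"
  unfolding range_span_def by (rule coeff.subspace_span)

lemma D_subset: "D \<subseteq> compl"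
  unfolding range_span_def
  by (rule coeff.span_minimal) (auto simp: V_mem completion.subspace_S)

text \<open>Span induction that retains membership in \<open>D\<close>, because an arbitrary family
  \<open>W\<close> of Weyl operators is known to be linear only there.\<close>

lemma D_induct [consumes 1, case_names zero step]:
  assumes "f \<in> D" "P 0"
    and step: "\<And>c \<xi> z f. \<lbrakk>f \<in> D; P f\<rbrakk> \<Longrightarrow> P (fun_scale c (V \<xi> z) + f)"
  shows "P f"
proof -
  have "f \<in> module.span fun_scale (\<Union>\<xi>. range (V \<xi>))" using assms(1) by (simp add: range_span_def)
  then have "f \<in> D \<and> P f"
  proof (induction rule: coeff.span_induct_alt)
    case base
    show ?case by (rule conjI[OF coeff.subspace_0[OF subspace_D] assms(2)])
  next
    case (step c x y)
    then show ?case
      using assms(3) V_mem_D coeff.subspace_add[OF subspace_D] coeff.subspace_scale[OF subspace_D]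
      by blast
  qed
  then show ?thesis ..
qed

text \<open>Conjugates are collected into the form \<open>u * cnj x\<close>, from which the adjoint
  with respect to \<open>complex_ip\<close> can be read off.\<close>

lemma kip_V: "kip (V \<xi> u) (V \<eta> z) = u * cnj (g \<xi> * g \<eta> * exp (ip \<eta> \<xi> / 2) * z)"
proof -
  have "kip (V \<xi> u) (V \<eta> z) = (u * g \<xi>) * cnj (z * g \<eta>) * exp (ip \<xi> \<eta> / 2)"
    unfolding V_def
    using kip_L[OF kernel_mem] kernel_mem completion.mem_scale
    by (simp add: K.ip_scale_left K.ip_scale_right ip_eq L_def)
  moreover have "ip \<xi> \<eta> = cnj (ip \<eta> \<xi>)" by (rule H.ip_hermitian) auto
  ultimately show ?thesis by (simp add: exp_cnj cnj_g)
qed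

lemma krein_adjoint_V:
  "krein_adjoint UNIV complex_ip kip (V \<xi>) (V \<eta> z) = g \<xi> * g \<eta> * exp (ip \<eta> \<xi> / 2) * z"
  unfolding krein_adjoint_def complex_ip_def
proof (rule the_equality)
  fix x assume "x \<in> UNIV \<and> (\<forall>u\<in>UNIV. kip (V \<xi> u) (V \<eta> z) = u * cnj x)"
  then have "kip (V \<xi> 1) (V \<eta> z) = 1 * cnj x" by blast
  then have "cnj (g \<xi> * g \<eta> * exp (ip \<eta> \<xi> / 2) * z) = cnj x" by (simp only: kip_V mult_1)
  then show "x = g \<xi> * g \<eta> * exp (ip \<eta> \<xi> / 2) * z" by (simp only: complex_cnj_cancel_iff)
qed (simp add: kip_V)

text \<open>The operator only rescales the vector \<open>V \<xi> 1\<close>, whose norm is therefore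
  a bound for every fundamental symmetry.\<close>

lemma bounded_linear_V: "bounded_linear_from_complex fun_scale compl kip (V \<xi>)"
  unfolding bounded_linear_from_complex_def
proof (intro conjI allI impI)
  show "Vector_Spaces.linear (*) fun_scale (V \<xi>)"
    by (intro Vector_Spaces.linear.intro module_hom.intro module_hom_axioms.intro module_fun_scale
        vector_space_fun_scale vector_space_over_itself.vector_space_axioms
        vector_space_over_itself.module_axioms)
      (auto simp: V_def fun_scale_def algebra_simps)
  show "range (V \<xi>) \<subseteq> compl" using V_mem by blast
  fix h J' assume "fundamental_symmetry fun_scale compl kip h J'"
  then interpret h: hilbert_space_on fun_scale compl h by (simp add: fundamental_symmetry_def)
  have "V \<xi> z = fun_scale z (V \<xi> 1)" for z by (simp add: V_def fun_scale_def mult.assoc)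
  then have "ip_norm h (V \<xi> z) \<le> ip_norm h (V \<xi> 1) * cmod z" for z
    using h.ip_norm_scale[OF V_mem, of z \<xi> 1] by (metis mult.commute order_refl)
  then show "\<exists>B. \<forall>z. ip_norm h (V \<xi> z) \<le> B * cmod z" by blast
qed

text \<open>For any fundamental symmetry, a vector \<open>f\<close> orthogonal to \<open>D\<close>
  gives a \<open>J' f\<close> that \<open>kip\<close> annihilates against every
  \<open>V \<xi> 1\<close>. By the reproducing property and since \<open>g\<close> has no zeros,
  \<open>J' f\<close> vanishes pointwise, so \<open>f = 0\<close>.\<close>

lemma dense_D: "krein_dense fun_scale compl kip D"
  unfolding krein_dense_def
proof (intro conjI allI impI D_subset)
  fix h J' assume sym: "fundamental_symmetry fun_scale compl kip h J'"
  then interpret h: hilbert_space_on fun_scale compl h by (simp add: fundamental_symmetry_def)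
  have J': "J' x \<in> compl" "J' (J' x) = x" "J' (fun_scale c x) = fun_scale c (J' x)"
    "y \<in> compl \<Longrightarrow> kip x y = h (J' x) y" if "x \<in> compl" for x y c
    using sym that by (auto simp: fundamental_symmetry_def linear_on_subspace_def)
  show "Metric_space.mtopology compl (ip_dist compl h) closure_of D = compl"
  proof (rule h.dense_if_orthogonal_trivial[OF subspace_D D_subset])
    fix f assume f: "f \<in> compl" and orth: "\<And>y. y \<in> D \<Longrightarrow> h f y = 0"
    have "J' f x = 0" for x
    proof -
      \<comment> \<open>The base point is \<open>J x\<close> because \<open>kip\<close> evaluates at
        the image under \<open>J\<close>, and \<open>J (J x) = x\<close>.\<close>
      have "0 = h f (V (J x) 1)" using orth V_mem_D by simp
      also have "\<dots> = kip (J' f) (V (J x) 1)" using J'(4)[OF J'(1)[OF f] V_mem] J'(2)[OF f] by simp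
      also have "\<dots> = g (J x) * J' f x"
        unfolding V_def using J'(1)[OF f] by (simp add: K.ip_scale_right kernel_mem kip_L J_J cnj_g)
      finally show ?thesis by (simp add: g_def)
    qed
    \<comment> \<open>Zero is written as a multiple of \<open>f\<close> so that homogeneity of
      \<open>J'\<close> yields \<open>J' (J' f) = 0\<close>.\<close>
    then have "J' f = fun_scale 0 f" by (simp add: fun_eq_iff fun_scale_def)
    then have "J' (J' f) = fun_scale 0 (J' f)" unfolding J'(3)[OF f, symmetric] by (rule arg_cong)
    then show "f = 0" unfolding J'(2)[OF f] by (simp add: fun_eq_iff fun_scale_def)
  qed
qed

section \<open>Weighted translations and their cocycle\<close>

definition weyl :: "'h \<Rightarrow> ('h \<Rightarrow> complex) \<Rightarrow> 'h \<Rightarrow> complex" where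
  "weyl \<xi> f = (\<lambda>x. g \<xi> * exp (hip \<xi> x / 2) * f (x - J \<xi>))"

definition \<alpha> :: "'h \<Rightarrow> 'h \<Rightarrow> complex" where
  "\<alpha> \<xi> \<eta> = exp (- (\<i> * complex_of_real (Im (ip \<xi> \<eta>)) / 2))"

definition \<sigma> :: "'h \<Rightarrow> 'h \<Rightarrow> complex" where
  "\<sigma> \<xi> \<eta> = exp (\<i> * complex_of_real (Im (ip \<xi> \<eta>)) / 2)"

lemma i_Im_ip: "\<i> * complex_of_real (Im (ip \<xi> \<eta>)) = (ip \<xi> \<eta> - ip \<eta> \<xi>) / 2"
  using H.ip_hermitian[of \<xi> \<eta>] by (simp add: complex_eq_iff)

lemma \<alpha>_\<sigma>: "\<alpha> \<xi> \<eta> * \<sigma> \<xi> \<eta> = 1"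
  unfolding \<alpha>_def \<sigma>_def mult_exp_exp by simp

text \<open>In the exponents, \<open>\<sigma>\<close> contributes a quarter of
  \<open>ip \<xi> \<eta> - ip \<eta> \<xi>\<close> and \<open>g\<close> minus a quarter of their
  sum. The terms \<open>ip \<xi> \<eta>\<close> cancel, and half of
  \<open>ip \<eta> \<xi> = hip \<eta> (J \<xi>)\<close> remains.\<close>

lemma g_add: "\<sigma> \<xi> \<eta> * g (\<xi> + \<eta>) = g \<xi> * g \<eta> * exp (- (hip \<eta> (J \<xi>) / 2))"
proof -
  have e: "ip (\<xi> + \<eta>) (\<xi> + \<eta>) = ip \<xi> \<xi> + ip \<eta> \<eta> + ip \<xi> \<eta> + ip \<eta> \<xi>"
    by (simp add: H.ip_add_left H.ip_add_right)
  have "(ip \<xi> \<eta> - ip \<eta> \<xi>) / 2 / 2 + - ((ip \<xi> \<xi> + ip \<eta> \<eta> + ip \<xi> \<eta> + ip \<eta> \<xi>) / 4)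
      = - (ip \<xi> \<xi> / 4) + - (ip \<eta> \<eta> / 4) + - (ip \<eta> \<xi> / 2)"
    by (simp add: field_simps)
  then show ?thesis
    unfolding g_def \<sigma>_def i_Im_ip mult_exp_exp e ip_eq[symmetric] by (rule arg_cong)
qed

lemma exp_hip_diff: "exp (hip \<eta> (x - J \<xi>) / 2) = exp (hip \<eta> x / 2) * exp (- (hip \<eta> (J \<xi>) / 2))"
  by (simp add: HH.ip_diff_right mult_exp_exp diff_divide_distrib)

lemma exp_hip_add: "exp (hip (\<xi> + \<eta>) x / 2) = exp (hip \<xi> x / 2) * exp (hip \<eta> x / 2)"
  by (simp add: HH.ip_add_left mult_exp_exp add_divide_distrib)

text \<open>As \<open>\<alpha> * \<sigma> = 1\<close>, this is the defining formula of the Weyl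
  operators solved for the operator. Translating by \<open>J \<xi>\<close> makes the kernel function
  produce precisely the exponential in \<open>g_add\<close>.\<close>

lemma weyl_V: "weyl \<xi> (V \<eta> z) = fun_scale (\<sigma> \<xi> \<eta>) (V (\<xi> + \<eta>) z)"
proof
  fix x
  have "weyl \<xi> (V \<eta> z) x = z * (g \<xi> * g \<eta> * exp (- (hip \<eta> (J \<xi>) / 2))) * exp (hip (\<xi> + \<eta>) x / 2)"
    by (simp add: weyl_def V_def fun_scale_def L_def exp_hip_diff exp_hip_add)
  also have "\<dots> = fun_scale (\<sigma> \<xi> \<eta>) (V (\<xi> + \<eta>) z) x"
    unfolding g_add[symmetric] by (simp add: V_def fun_scale_def L_def)
  finally show "weyl \<xi> (V \<eta> z) x = fun_scale (\<sigma> \<xi> \<eta>) (V (\<xi> + \<eta>) z) x" .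
qed

text \<open>The outer translation shifts the weight of the inner one, which releases the exponential
  of \<open>g_add\<close>; additivity of \<open>J\<close> merges the two translations. The relation
  holds for all functions, before any domain is imposed.\<close>

lemma weyl_weyl: "weyl \<xi> (weyl \<eta> f) = fun_scale (\<sigma> \<xi> \<eta>) (weyl (\<xi> + \<eta>) f)"
proof
  fix x
  have "weyl \<xi> (weyl \<eta> f) x = (g \<xi> * g \<eta> * exp (- (hip \<eta> (J \<xi>) / 2))) * exp (hip (\<xi> + \<eta>) x / 2)
      * f (x - J (\<xi> + \<eta>))"
    by (simp add: weyl_def exp_hip_diff exp_hip_add J_add algebra_simps)
  also have "\<dots> = fun_scale (\<sigma> \<xi> \<eta>) (weyl (\<xi> + \<eta>) f) x"
    unfolding g_add[symmetric] by (simp add: weyl_def fun_scale_def)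
  finally show "weyl \<xi> (weyl \<eta> f) x = fun_scale (\<sigma> \<xi> \<eta>) (weyl (\<xi> + \<eta>) f) x" .
qed

lemma weyl_add: "weyl \<xi> (f + h) = weyl \<xi> f + weyl \<xi> h"
  and weyl_scale: "weyl \<xi> (fun_scale c f) = fun_scale c (weyl \<xi> f)"
  and weyl_0: "weyl \<xi> 0 = 0"
  by (auto simp: weyl_def fun_scale_def fun_eq_iff algebra_simps)

lemma weyl_mem_D: "f \<in> D \<Longrightarrow> weyl \<xi> f \<in> D"
proof (induction rule: D_induct)
  case zero
  show ?case unfolding weyl_0 by (rule coeff.subspace_0[OF subspace_D])
next
  case (step c \<eta> z f)
  then show ?case
    unfolding weyl_add weyl_scale weyl_V
    by (intro coeff.subspace_add[OF subspace_D] coeff.subspace_scale[OF subspace_D] V_mem_D)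
qed

section \<open>Weyl operators as partial maps: existence, uniqueness and product\<close>

definition weyl_op :: "'h \<Rightarrow> ('h \<Rightarrow> complex) \<rightharpoonup> ('h \<Rightarrow> complex)" where
  "weyl_op \<xi> = (\<lambda>f. if f \<in> D then Some (weyl \<xi> f) else None)"

lemma dom_weyl_op: "dom (weyl_op \<xi>) = D"
  by (auto simp: weyl_op_def dom_def)

lemma fun_scale_fun_scale: "fun_scale c (fun_scale d f) = fun_scale (c * d) f"
  by (simp add: fun_scale_def mult.assoc)

lemma weyl_operators_weyl_op: "weyl_operators \<alpha> fun_scale compl V weyl_op"
  unfolding weyl_operators_def unbounded_operator_def dom_weyl_op
proof (intro allI conjI refl subspace_D D_subset)
  fix \<xi>
  show "ran (weyl_op \<xi>) \<subseteq> compl"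
    using weyl_mem_D D_subset by (auto simp: ran_def weyl_op_def split: if_splits)
  show "linear_on_subspace fun_scale D (\<lambda>x. the (weyl_op \<xi> x))"
    using coeff.subspace_add[OF subspace_D] coeff.subspace_scale[OF subspace_D]
    by (simp add: linear_on_subspace_def weyl_op_def weyl_add weyl_scale)
  show "scale_operator fun_scale (\<alpha> \<xi> \<eta>) (weyl_op \<xi>) (V \<eta> z) = Some (V (\<xi> + \<eta>) z)" for \<eta> z
    by (simp add: scale_operator_def weyl_op_def V_mem_D weyl_V fun_scale_fun_scale \<alpha>_\<sigma>)
qed

text \<open>Since \<open>\<alpha>\<close> is invertible, the formula fixes the values on all
  \<open>V \<eta> z\<close>, and linearity fixes them on the span. This reduces a claim about every
  admissible \<open>W\<close> to one about \<open>weyl_op\<close>.\<close>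

lemma weyl_operators_unique:
  assumes W: "weyl_operators \<alpha> fun_scale compl V W"
  shows "W = weyl_op"
proof (intro ext)
  fix \<xi> f
  have dom: "dom (W \<xi>) = D"
    and lin: "linear_on_subspace fun_scale D (\<lambda>x. the (W \<xi> x))"
    and WV: "scale_operator fun_scale (\<alpha> \<xi> \<eta>) (W \<xi>) (V \<eta> z) = Some (V (\<xi> + \<eta>) z)" for \<eta> z
    using W unfolding weyl_operators_def unbounded_operator_def by metis+
  show "W \<xi> f = weyl_op \<xi> f"
  proof (cases "f \<in> D")
    case False
    then have "W \<xi> f = None" using dom by blast
    then show ?thesis using False by (simp add: weyl_op_def)
  next
    case True
    then have "the (W \<xi> f) = weyl \<xi> f"
    proof (induction rule: D_induct)
      case zero
      \<comment> \<open>The value at 0 is extracted from homogeneity with scalar 0.\<close>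
      have "the (W \<xi> (fun_scale 0 0)) = fun_scale 0 (the (W \<xi> 0))"
        using lin coeff.subspace_0[OF subspace_D] unfolding linear_on_subspace_def by blast
      then have "the (W \<xi> 0) = 0" by simp
      then show ?case unfolding weyl_0 .
    next
      case (step c \<eta> z f)
      obtain w where w: "W \<xi> (V \<eta> z) = Some w" "fun_scale (\<alpha> \<xi> \<eta>) w = V (\<xi> + \<eta>) z"
        using WV[of \<eta> z] by (auto simp: scale_operator_def)
      have "weyl \<xi> (V \<eta> z) = fun_scale (\<sigma> \<xi> \<eta> * \<alpha> \<xi> \<eta>) w"
        unfolding weyl_V w(2)[symmetric] fun_scale_fun_scale ..
      then have "weyl \<xi> (V \<eta> z) = w"
        using \<alpha>_\<sigma>[of \<xi> \<eta>] by (simp add: mult.commute)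
      moreover have "the (W \<xi> (fun_scale c (V \<eta> z) + f))
          = fun_scale c (the (W \<xi> (V \<eta> z))) + the (W \<xi> f)"
        using lin step(1) V_mem_D coeff.subspace_scale[OF subspace_D V_mem_D]
        by (simp add: linear_on_subspace_def)
      ultimately show ?case
        by (simp only: weyl_add weyl_scale w(1) step(2) option.sel)
    qed
    moreover have "W \<xi> f \<noteq> None" using True dom by blast
    ultimately show ?thesis using True by (auto simp: weyl_op_def)
  qed
qed

text \<open>Because \<open>weyl\<close> maps \<open>D\<close> into itself, the maximal domain of the
  product is all of \<open>D\<close>, so the domains agree as well as the values.\<close>

lemma weyl_op_comp: "weyl_op \<xi> \<circ>\<^sub>m weyl_op \<eta> = scale_operator fun_scale (\<sigma> \<xi> \<eta>) (weyl_op (\<xi> + \<eta>))"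
  by (auto simp: map_comp_def weyl_op_def scale_operator_def weyl_mem_D weyl_weyl fun_eq_iff)

text \<open>The phase contributes a quarter of \<open>ip \<eta> \<xi> - ip \<xi> \<eta>\<close> and
  the mixed terms of the quadratic part a quarter of their sum, so only half of
  \<open>ip \<eta> \<xi>\<close> survives.\<close>

lemma kernel_eq:
  "exp (\<i> * complex_of_real (Im (ip \<eta> \<xi>)) / 2) * exp (- (ip (\<xi> - \<eta>) (\<xi> - \<eta>) / 4))
    = g \<xi> * g \<eta> * exp (ip \<eta> \<xi> / 2)"
proof -
  have "\<xi> - \<eta> = \<xi> + scl (-1) \<eta>" by simp
  then have e: "ip (\<xi> - \<eta>) (\<xi> - \<eta>) = ip \<xi> \<xi> + ip \<eta> \<eta> - ip \<xi> \<eta> - ip \<eta> \<xi>"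
    by (simp only: H.ip_add_left H.ip_add_right H.ip_scale_left H.ip_scale_right UNIV_I) simp
  have "(ip \<eta> \<xi> - ip \<xi> \<eta>) / 2 / 2 + - ((ip \<xi> \<xi> + ip \<eta> \<eta> - ip \<xi> \<eta> - ip \<eta> \<xi>) / 4)
      = - (ip \<xi> \<xi> / 4) + - (ip \<eta> \<eta> / 4) + ip \<eta> \<xi> / 2"
    by (simp add: field_simps)
  then show ?thesis
    unfolding g_def i_Im_ip mult_exp_exp e by (rule arg_cong)
qed

end

theorem theorem5p1:
  fixes scl :: "complex \<Rightarrow> 'h::ab_group_add \<Rightarrow> 'h"
    and ip K \<alpha> \<sigma> :: "'h \<Rightarrow> 'h \<Rightarrow> complex"
  assumes "krein_space scl UNIV ip"
    and "\<And>\<xi> \<eta>. K \<xi> \<eta> =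
           exp (\<i> * complex_of_real (Im (ip \<eta> \<xi>)) / 2) * exp (- (ip (\<xi> - \<eta>) (\<xi> - \<eta>) / 4))"
    and "\<And>\<xi> \<eta>. \<alpha> \<xi> \<eta> = exp (- (\<i> * complex_of_real (Im (ip \<xi> \<eta>)) / 2))"
    and "\<And>\<xi> \<eta>. \<sigma> \<xi> \<eta> = exp (\<i> * complex_of_real (Im (ip \<xi> \<eta>)) / 2)"
  shows "\<exists>(S :: ('h \<Rightarrow> complex) set) ip' V.
           kolmogorov_decomposition K fun_scale S ip' V \<and>
           krein_dense fun_scale S ip' (range_span fun_scale V) \<and>
           (\<exists>!W. weyl_operators \<alpha> fun_scale S V W) \<and>
           (\<forall>W. weyl_operators \<alpha> fun_scale S V W \<longrightarrow>
              (\<forall>\<xi> \<eta>. W \<xi> \<circ>\<^sub>m W \<eta> = scale_operator fun_scale (\<sigma> \<xi> \<eta>) (W (\<xi> + \<eta>))))"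
proof -
  \<comment> \<open>The choice of symmetry affects only the constructed space; \<open>K\<close>,
    \<open>\<alpha>\<close> and \<open>\<sigma>\<close> depend on \<open>ip\<close> alone.\<close>
  obtain hip J where "fundamental_symmetry scl UNIV ip hip J"
    using krein_space.ex_fundamental_symmetry[OF assms(1)] by blast
  with assms(1) interpret W: weyl_kernel scl ip hip J
    by (intro weyl_kernel.intro)
  have \<alpha>: "\<alpha> = W.\<alpha>" and \<sigma>: "\<sigma> = W.\<sigma>"
    using assms(3,4) by (auto simp: fun_eq_iff W.\<alpha>_def W.\<sigma>_def)
  have "K \<xi> \<eta> = W.g \<xi> * W.g \<eta> * exp (ip \<eta> \<xi> / 2)" for \<xi> \<eta>
    using assms(2) W.kernel_eq by simp
  then have "kolmogorov_decomposition K fun_scale W.compl W.kip W.V"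
    unfolding kolmogorov_decomposition_def
    using W.K.krein_space_axioms W.bounded_linear_V W.krein_adjoint_V W.dense_D by simp
  moreover have "\<exists>!W'. weyl_operators \<alpha> fun_scale W.compl W.V W'"
    unfolding \<alpha> using W.weyl_operators_weyl_op W.weyl_operators_unique by blast
  moreover have "W' \<xi> \<circ>\<^sub>m W' \<eta> = scale_operator fun_scale (\<sigma> \<xi> \<eta>) (W' (\<xi> + \<eta>))"
    if "weyl_operators \<alpha> fun_scale W.compl W.V W'" for W' \<xi> \<eta>
    using W.weyl_operators_unique[of W'] that W.weyl_op_comp unfolding \<alpha> \<sigma> by simp
  ultimately show ?thesis
    using W.dense_D by blast
qed

end
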